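(* Every $2$-dimensional hypercut $C$ over $\mathbb{F}_2$ on vertex set $[n]$ has at most $\binom{n}{3}-\frac34n^2+o(n^2)$ triples. Moreover, for every such hypercut $C$ attaining this bound (i.e. $|C|=\binom{n}{3}-\frac34n^2+o(n^2)$) there is a vertex $v$ such that, letting $G=\mathrm{link}_v(C)$ and $\bar G$ its complement, one of the following holds: (1) $\bar G$ has one vertex of degree $\frac n2\pm o(n)$ and all other vertices have degree $o(n)$, and moreover $|E(G)|=n-1+o(n)$; (2) $\bar G$ has one vertex of degree $n-o(n)$, one vertex of degree $\frac n2\pm o(n)$, and all other vertices have degree $o(n)$, and moreover $|E(G)|=2n\pm o(n)$.
   Context: A $2$-dimensional hypercut over $\mathbb{F}_2$ on $[n]$ is an inclusion-minimal set of triples in $\binom{[n]}{3}$ meeting every maximal $\mathbb{F}_2$-acyclic set of triples (where a set of triples is acyclic if the indicator vectors of their boundaries $\{ab,bc,ac\}\subseteq\binom{[n]}{2}$ are linearly independent over $\mathbb{F}_2$). For a set $C$ of triples and a vertex $v$, $\mathrm{link}_v(C)$ is the graph on vertex set $[n]\setminus\{v\}$ whose edges are the pairs $\{a,b\}$ with $\{v,a,b\}\in C$; $\bar G$ denotes the complement graph on the same $n-1$ vertices. Asymptotic notation is as $n\to\infty$.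
   Formalization: The edge counts n-1+o(n) and 2n±o(n) are stated for the complement Ḡ instead of G: the degree conditions force |E(G)| ~ n²/2, so the claim as written fails for extremal hypercuts (e.g. those whose Ḡ is a spider with legs of length 2). *)

theory Defs
  imports
    Complex_Main
    "HOL-Library.Z2"
    "HOL-Library.Function_Algebras"
    "HOL-Library.Indicator_Function"
    "HOL-Library.Landau_Symbols"
    "HOL-Library.Ramsey"
begin

text \<open>
  Vectors over the two-element field \<^typ>\<open>bit\<close> are functions on \<^typ>\<open>nat set\<close> with pointwise
  operations. Boundary vectors vanish outside the pairs, so linear independence is the same as
  in the space of vectors indexed by the pairs of the ground set.
\<close>

definition F2_scale :: "bit \<Rightarrow> (nat set \<Rightarrow> bit) \<Rightarrow> nat set \<Rightarrow> bit" where
  "F2_scale c f = (\<lambda>e. c * f e)"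

global_interpretation F2: vector_space F2_scale
  by unfold_locales (auto simp: F2_scale_def fun_eq_iff algebra_simps)

definition boundary_vec :: "nat set \<Rightarrow> nat set \<Rightarrow> bit" where
  "boundary_vec T = indicator (nsets T 2)"

text \<open>
  Distinct triples have distinct boundary vectors, so independence of the set of boundary vectors
  is independence of the family indexed by the triples.
\<close>

lemma inj_on_boundary_vec: "inj_on boundary_vec (nsets A 3)"
proof (rule inj_onI)
  fix S T assume S: "S \<in> nsets A 3" and T: "T \<in> nsets A 3"
    and eq: "boundary_vec S = boundary_vec T"
  have "nsets S 2 = nsets T 2"
  proof (rule set_eqI)
    fix e
    have "boundary_vec S e = boundary_vec T e" by (simp add: eq)
    then show "e \<in> nsets S 2 \<longleftrightarrow> e \<in> nsets T 2"
      by (simp add: boundary_vec_def indicator_def of_bool_def split: if_splits)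
  qed
  moreover have "\<Union>(nsets U 2) = U" if U: "U \<in> nsets A 3" for U
  proof -
    obtain x y z where "U = {x, y, z}" "x \<noteq> y" "x \<noteq> z" "y \<noteq> z"
      using U by (auto simp: nsets_3_eq)
    then show ?thesis by (auto simp: nsets_2_eq)
  qed
  ultimately show "S = T" using S T by metis
qed

definition triples :: "nat \<Rightarrow> nat set set" where
  "triples n = nsets {1..n} 3"

definition F2_acyclic :: "nat set set \<Rightarrow> bool" where
  "F2_acyclic B \<longleftrightarrow> F2.independent (boundary_vec ` B)"

definition maximal_acyclic :: "nat \<Rightarrow> nat set set \<Rightarrow> bool" where
  "maximal_acyclic n B \<longleftrightarrow> B \<subseteq> triples n \<and> F2_acyclic B \<and>
     (\<forall>B'. B \<subset> B' \<and> B' \<subseteq> triples n \<longrightarrow> \<not> F2_acyclic B')"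

definition meets_maximal_acyclic :: "nat \<Rightarrow> nat set set \<Rightarrow> bool" where
  "meets_maximal_acyclic n C \<longleftrightarrow> (\<forall>B. maximal_acyclic n B \<longrightarrow> C \<inter> B \<noteq> {})"

definition hypercut :: "nat \<Rightarrow> nat set set \<Rightarrow> bool" where
  "hypercut n C \<longleftrightarrow> C \<subseteq> triples n \<and> meets_maximal_acyclic n C \<and>
     (\<forall>D. D \<subset> C \<longrightarrow> \<not> meets_maximal_acyclic n D)"

text \<open>A graph is represented by its set of edges; its vertex set is given separately.\<close>

definition link :: "nat \<Rightarrow> nat \<Rightarrow> nat set set \<Rightarrow> nat set set" where
  "link n v C = {e \<in> nsets ({1..n} - {v}) 2. insert v e \<in> C}"

text \<open>
  In the structure theorem both the degrees and the number of edges (about \<open>n\<close>, resp. \<open>2 * n\<close>) are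
  those of the complement of the link. The link itself has \<open>n\<^sup>2 / 2 - o(n\<^sup>2)\<close> edges there, since the
  degree conditions leave the complement only \<open>o(n\<^sup>2)\<close> edges.
\<close>

definition complement_graph :: "'a set \<Rightarrow> 'a set set \<Rightarrow> 'a set set" where
  "complement_graph V E = nsets V 2 - E"

definition degree :: "'a set set \<Rightarrow> 'a \<Rightarrow> nat" where
  "degree E u = card {e \<in> E. u \<in> e}"

end

theory Submission
  imports Defs
begin

text \<open>
  A hypercut \<open>C\<close> is a cocircuit of the matroid of boundaries, so it consists of the triples with an
  odd number of edges in the link of any vertex. By minimality, every link is a single forcing
  class (Gallai): an edge forces another edge at the same vertex if their other ends are not
  adjacent. Choose \<open>v\<close> in few triples outside \<open>C\<close>; then the complement \<open>D\<close> of the link of \<open>v\<close> has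
  \<open>m = O(n)\<close> edges, and counting triples with exactly one edge of \<open>D\<close> shows that at least
  \<open>m n - \<Sum> d\<^sup>2\<close> triples are outside \<open>C\<close>.

  Let \<open>S\<close> be the boundedly many vertices of linear degree in \<open>D\<close>. Two components of \<open>D - S\<close> all of
  whose vertices have the same neighbours in \<open>S\<close> would span a separate forcing class, so almost
  all of the \<open>q\<close> components split the neighbourhood of some \<open>i \<in> S\<close>. If \<open>b i\<close> components split that of
  \<open>i\<close>, then \<open>b i \<le> d i \<le> n - b i\<close>, whence up to lower order terms
  \<open>m n - \<Sum> d\<^sup>2 \<ge> n (n - q) + \<Sum> d i (n - d i) \<ge> n (n - q) + \<Sum> b i (n - b i) \<ge> n\<^sup>2 - q\<^sup>2 \<ge> 3/4 n\<^sup>2\<close>,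
  as \<open>q \<le> n / 2\<close>. Near equality forces one \<open>b i\<close> close to \<open>n / 2\<close> and every other \<open>d i\<close> close to \<open>0\<close> or
  \<open>n\<close>; as \<open>m\<close> is at most about \<open>9/4 n\<close>, at most one is close to \<open>n\<close>.
\<close>

section \<open>Hypercuts as cocircuits\<close>

interpretation F2_to_bit: vector_space_pair F2_scale "(*) :: bit \<Rightarrow> bit \<Rightarrow> bit"
  by unfold_locales (auto simp: algebra_simps)

text \<open>Scalars are 0 or 1 over the two-element field, so additivity already gives
  linearity.\<close>

lemma subspace_zeros_additive:
  assumes "Modules.additive \<phi>"
  shows "F2.subspace {x. \<phi> x = (0 :: bit)}"
proof -
  interpret Modules.additive \<phi> by fact
  have "\<phi> (F2_scale c x) = 0" if "\<phi> x = 0" for c x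
  proof (cases "c = 0")
    case True
    have "F2_scale c x = 0" using True by (simp add: F2_scale_def fun_eq_iff)
    then show ?thesis by (simp only: zero)
  next
    case False
    then have "F2_scale c x = x" by (simp add: F2_scale_def fun_eq_iff)
    then show ?thesis using that by simp
  qed
  then show ?thesis unfolding F2.subspace_def by (auto simp: add zero)
qed

text \<open>Otherwise the triple could be added. With \<open>maximal_acyclic_if_spans\<close>,
  maximal acyclic sets are exactly those whose boundary vectors form a basis of the span of all
  boundaries.\<close>

lemma maximal_acyclic_spans:
  assumes B: "maximal_acyclic n B" and T: "T \<in> triples n"
  shows "boundary_vec T \<in> F2.span (boundary_vec ` B)"
proof (rule ccontr)
  assume nin: "boundary_vec T \<notin> F2.span (boundary_vec ` B)"
  then have "T \<notin> B" by (auto intro: F2.span_base)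
  moreover have "F2_acyclic (insert T B)"
    using B F2.independent_insertI[OF nin] by (simp add: F2_acyclic_def maximal_acyclic_def)
  ultimately show False
    using B T unfolding maximal_acyclic_def by (metis insert_subset psubsetI subset_insertI insertI1)
qed

lemma maximal_acyclic_if_spans:
  assumes "B \<subseteq> triples n" "F2_acyclic B"
    and sp: "boundary_vec ` triples n \<subseteq> F2.span (boundary_vec ` B)"
  shows "maximal_acyclic n B"
  unfolding maximal_acyclic_def
proof (intro conjI allI impI assms(1,2) notI)
  fix B' assume B': "B \<subset> B' \<and> B' \<subseteq> triples n" and ac: "F2_acyclic B'"
  then obtain T where T: "T \<in> B'" "T \<notin> B" by blast
  \<comment> \<open>By injectivity, removing \<open>T\<close> removes its vector from the image, as
    the definition of dependence requires.\<close>
  have "boundary_vec T \<notin> boundary_vec ` (B' - {T})"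
    using inj_on_boundary_vec[of "{1..n}"] B' T
    unfolding triples_def inj_on_def by (auto simp: subset_iff)
  then have "boundary_vec ` B' - {boundary_vec T} = boundary_vec ` (B' - {T})" using T by blast
  then have "boundary_vec T \<notin> F2.span (boundary_vec ` (B' - {T}))"
    using ac T unfolding F2_acyclic_def F2.dependent_def by (metis imageI)
  moreover have "boundary_vec T \<in> F2.span (boundary_vec ` B)" using sp B' T by blast
  ultimately show False
    using F2.span_mono[of "boundary_vec ` B" "boundary_vec ` (B' - {T})"] B' T by blast
qed

text \<open>Triples on which \<open>\<phi>\<close> vanishes span only vectors of its kernel, so they
  contain no basis once \<open>\<phi>\<close> is nonzero at some triple.\<close>

lemma meets_if_nonzero:
  assumes "Modules.additive \<phi>" and T: "T \<in> triples n" "\<phi> (boundary_vec T) = (1 :: bit)"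
  shows "meets_maximal_acyclic n {T \<in> triples n. \<phi> (boundary_vec T) = 1}"
  unfolding meets_maximal_acyclic_def
proof (intro allI impI notI)
  fix B assume B: "maximal_acyclic n B"
    and "{T \<in> triples n. \<phi> (boundary_vec T) = 1} \<inter> B = {}"
  moreover have "B \<subseteq> triples n" using B by (simp add: maximal_acyclic_def)
  ultimately have "\<forall>T \<in> B. \<phi> (boundary_vec T) \<noteq> 1" by blast
  then have "\<forall>T \<in> B. \<phi> (boundary_vec T) = 0" by simp
  then have "boundary_vec ` B \<subseteq> {x. \<phi> x = 0}" by blast
  from F2.span_minimal[OF this subspace_zeros_additive[OF assms(1)]]
  have "F2.span (boundary_vec ` B) \<subseteq> {x. \<phi> x = 0}" .
  with maximal_acyclic_spans[OF B T(1)] T(2) show False by auto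
qed

text \<open>The support of a nonzero functional meets every basis. Minimality of hypercuts enters
  only here.\<close>

lemma hypercut_minimal:
  assumes "hypercut n C" "Modules.additive \<phi>" "T \<in> triples n" "\<phi> (boundary_vec T) = (1 :: bit)"
    and "{T \<in> triples n. \<phi> (boundary_vec T) = 1} \<subseteq> C"
  shows "C = {T \<in> triples n. \<phi> (boundary_vec T) = 1}"
  using meets_if_nonzero[OF assms(2-4)] assms(1,5) unfolding hypercut_def by blast

lemma exists_maximal_acyclic_subset:
  assumes W: "W \<subseteq> triples n" and sp: "boundary_vec ` triples n \<subseteq> F2.span (boundary_vec ` W)"
  obtains B where "B \<subseteq> W" "maximal_acyclic n B"
proof -
  obtain I where I: "I \<subseteq> boundary_vec ` W" "F2.independent I" "boundary_vec ` W \<subseteq> F2.span I"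
    using F2.maximal_independent_subset[of "boundary_vec ` W"] by blast
  define B where "B = {T \<in> W. boundary_vec T \<in> I}"
  have bB: "boundary_vec ` B = I" using I(1) by (auto simp: B_def)
  have "F2.span (boundary_vec ` W) \<subseteq> F2.span I"
    by (rule F2.span_minimal[OF I(3) F2.subspace_span])
  then have "boundary_vec ` triples n \<subseteq> F2.span (boundary_vec ` B)" unfolding bB using sp by blast
  moreover have "F2_acyclic B" "B \<subseteq> triples n" "B \<subseteq> W"
    using I(2) W unfolding F2_acyclic_def bB by (auto simp: B_def)
  ultimately show thesis using that maximal_acyclic_if_spans by blast
qed

lemma hypercut_nonempty:
  assumes "hypercut n C"
  shows "C \<noteq> {}"
proof -
  obtain B where "maximal_acyclic n B"
    using exists_maximal_acyclic_subset[OF order_refl F2.span_superset] .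
  then show ?thesis using assms unfolding hypercut_def meets_maximal_acyclic_def by blast
qed

lemma hypercut_imp_ge_3:
  assumes "hypercut n C"
  shows "3 \<le> n"
proof -
  obtain T where "T \<subseteq> {1..n}" "card T = 3"
    using hypercut_nonempty[OF assms] assms by (auto simp: hypercut_def triples_def nsets_def)
  then show ?thesis using card_mono[of "{1..n}" T] by simp
qed

text \<open>The triples outside \<open>C\<close> do not span, since a basis among them would miss
  \<open>C\<close>. So some functional kills them all but is nonzero at a triple, and minimality
  identifies its support with \<open>C\<close>.\<close>

lemma hypercut_functional:
  assumes C: "hypercut n C"
  obtains \<phi> :: "(nat set \<Rightarrow> bit) \<Rightarrow> bit" where "Modules.additive \<phi>"
    "C = {T \<in> triples n. \<phi> (boundary_vec T) = 1}"
proof -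
  let ?S = "boundary_vec ` (triples n - C)"
  have "\<not> boundary_vec ` triples n \<subseteq> F2.span ?S"
  proof
    assume "boundary_vec ` triples n \<subseteq> F2.span ?S"
    then obtain B where "B \<subseteq> triples n - C" "maximal_acyclic n B"
      using exists_maximal_acyclic_subset[of "triples n - C"] by blast
    then show False using C unfolding hypercut_def meets_maximal_acyclic_def by blast
  qed
  then obtain T where T: "T \<in> triples n" "boundary_vec T \<notin> F2.span ?S" by blast
  obtain I where I: "I \<subseteq> ?S" "F2.independent I" "?S \<subseteq> F2.span I"
    using F2.maximal_independent_subset[of ?S] by blast
  have TI: "boundary_vec T \<notin> F2.span I" using T(2) F2.span_mono[OF I(1)] by blast
  from F2.independent_insertI[OF this I(2)]
  obtain \<phi> where lin: "Vector_Spaces.linear F2_scale (*) \<phi>"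
    and \<phi>: "\<forall>x \<in> insert (boundary_vec T) I. \<phi> x = (if x = boundary_vec T then 1 else 0 :: bit)"
    using F2_to_bit.linear_independent_extend[of "insert (boundary_vec T) I"
        "\<lambda>x. if x = boundary_vec T then 1 else 0"] by blast
  have add: "Modules.additive \<phi>"
    by unfold_locales (rule module_hom.add[OF Vector_Spaces.linear.axioms(3)[OF lin]])
  have "boundary_vec T \<notin> I" using TI F2.span_base by blast
  then have "I \<subseteq> {x. \<phi> x = 0}" using \<phi> by auto
  from F2.span_minimal[OF this subspace_zeros_additive[OF add]]
  have "F2.span I \<subseteq> {x. \<phi> x = 0}" .
  then have "{T \<in> triples n. \<phi> (boundary_vec T) = 1} \<subseteq> C" using I(3) by fastforce
  moreover have "\<phi> (boundary_vec T) = 1" using \<phi> by simp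
  ultimately show thesis using hypercut_minimal[OF C add T(1)] add that by blast
qed

section \<open>Parity in 4-sets and the links of a hypercut\<close>

lemma mem_nsets_3_2:
  assumes "a \<noteq> b" "a \<noteq> c" "b \<noteq> c"
  shows "e \<in> nsets {a, b, c} 2 \<longleftrightarrow> e = {a, b} \<or> e = {a, c} \<or> e = {b, c}"
  using assms by (auto simp: nsets_2_eq)

text \<open>Every edge of the 4-set lies in exactly two of its four triples, so the four boundaries
  sum to zero; over the two-element field each is then the sum of the others.\<close>

lemma boundary_boundary:
  assumes "distinct [v, a, b, c]"
  shows "boundary_vec {a, b, c} = boundary_vec {v, a, b} + boundary_vec {v, a, c} + boundary_vec {v, b, c}"
proof
  fix e :: "nat set"
  have neq: "v \<noteq> a" "v \<noteq> b" "v \<noteq> c" "a \<noteq> b" "a \<noteq> c" "b \<noteq> c" using assms by auto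
  have bv: "boundary_vec {x, y, z} e = of_bool (e = {x, y} \<or> e = {x, z} \<or> e = {y, z})"
    if "x \<noteq> y" "x \<noteq> z" "y \<noteq> z" for x y z
    using mem_nsets_3_2[OF that] by (simp add: boundary_vec_def indicator_def)
  consider "e = {a, b}" | "e = {a, c}" | "e = {b, c}" | "e = {v, a}" | "e = {v, b}" | "e = {v, c}"
    | "e \<notin> {{a, b}, {a, c}, {b, c}, {v, a}, {v, b}, {v, c}}" by blast
  then show "boundary_vec {a, b, c} e = (boundary_vec {v, a, b} + boundary_vec {v, a, c} + boundary_vec {v, b, c}) e"
    unfolding plus_fun_apply bv[OF neq(1,2,4)] bv[OF neq(1,3,5)] bv[OF neq(2,3,6)] bv[OF neq(4-6)]
    by cases (use neq in \<open>simp_all add: doubleton_eq_iff\<close>)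
qed

text \<open>The nested equivalence is the parity condition: it holds iff an odd number of the three
  propositions hold.\<close>

lemma odd_of_bool: "of_bool p + of_bool q + of_bool r = (1 :: bit) \<longleftrightarrow> p = (q = r)"
  by (cases p; cases q; cases r) simp_all

lemma triples_iff: "{a, b, c} \<in> triples n \<longleftrightarrow> distinct [a, b, c] \<and> {a, b, c} \<subseteq> {1..n}"
  by (auto simp: triples_def nsets_def card_insert_if split: if_splits)

text \<open>The boundary of the 4-set \<open>{v, a, b, c}\<close> vanishes, so it contains an even number of
  triples of the hypercut.\<close>

lemma hypercut_cocycle:
  assumes C: "hypercut n C" and d: "distinct [v, a, b, c]" and V: "{v, a, b, c} \<subseteq> {1..n}"
  shows "{a, b, c} \<in> C \<longleftrightarrow>
    (({a, b} \<in> link n v C) = (({a, c} \<in> link n v C) = ({b, c} \<in> link n v C)))"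
proof -
  obtain \<phi> :: "(nat set \<Rightarrow> bit) \<Rightarrow> bit" where "Modules.additive \<phi>"
    and C_eq: "C = {T \<in> triples n. \<phi> (boundary_vec T) = 1}"
    using hypercut_functional[OF C] by blast
  then interpret Modules.additive \<phi> by simp
  have l: "{x, y} \<in> link n v C \<longleftrightarrow> \<phi> (boundary_vec {v, x, y}) = 1"
    if "distinct [v, x, y]" "{v, x, y} \<subseteq> {1..n}" for x y
    using that unfolding C_eq link_def
    by (simp add: triples_iff nsets_def card_insert_if insert_commute)
  have "{a, b, c} \<in> C \<longleftrightarrow> \<phi> (boundary_vec {v, a, b}) + \<phi> (boundary_vec {v, a, c})
      + \<phi> (boundary_vec {v, b, c}) = 1"
    using d V unfolding C_eq by (simp add: triples_iff boundary_boundary[OF d] add)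
  also have "\<dots> \<longleftrightarrow> (({a, b} \<in> link n v C) = (({a, c} \<in> link n v C) = ({b, c} \<in> link n v C)))"
    using d V by (auto simp: l)
  finally show ?thesis .
qed

text \<open>If two edges of the link at a common vertex span a non-edge, any hypercut inside \<open>C\<close>
  contains both or neither; so minimality of \<open>C\<close> makes the link a single forcing class in the
  sense of Gallai.\<close>

lemma link_single_class:
  assumes C: "hypercut n C" and v: "v \<in> {1..n}" and F: "F \<subseteq> link n v C" "F \<noteq> {}"
    and closed: "\<And>a b c. {a, b} \<in> F \<Longrightarrow> {b, c} \<in> link n v C \<Longrightarrow> a \<noteq> c \<Longrightarrow> {a, c} \<notin> link n v C \<Longrightarrow> {b, c} \<in> F"
  shows "F = link n v C"
proof -
  have fin: "finite F"
    by (rule finite_subset[OF F(1)], rule finite_subset[of _ "nsets ({1..n} - {v}) 2"])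
      (auto simp: link_def finite_imp_finite_nsets)
  \<comment> \<open>The triples through \<open>v\<close> in the support of this functional are the
    cone over \<open>F\<close>. Once the support is known to lie in \<open>C\<close>, minimality
    makes it equal to \<open>C\<close>, and \<open>F\<close> is the whole link.\<close>
  define \<phi> :: "(nat set \<Rightarrow> bit) \<Rightarrow> bit" where "\<phi> x = (\<Sum>e\<in>F. x e)" for x
  have add: "Modules.additive \<phi>" by unfold_locales (simp add: \<phi>_def sum.distrib del: add_bit_eq_xor)
  have FV: "{a, b} \<in> F \<Longrightarrow> a \<noteq> b \<and> a \<noteq> v \<and> b \<noteq> v \<and> a \<in> {1..n} \<and> b \<in> {1..n}" for a b
    using F(1) unfolding link_def nsets_def by (auto simp: card_insert_if split: if_splits)
  have \<phi>T: "\<phi> (boundary_vec {a, b, c}) = of_bool ({a, b} \<in> F) + of_bool ({a, c} \<in> F) + of_bool ({b, c} \<in> F)"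
    if "distinct [a, b, c]" for a b c
  proof -
    have "\<phi> (boundary_vec {a, b, c}) = (\<Sum>e\<in>F. of_bool (e = {a, b}) + of_bool (e = {a, c}) + of_bool (e = {b, c}))"
      unfolding \<phi>_def boundary_vec_def using that
      by (intro sum.cong refl) (auto simp: indicator_def mem_nsets_3_2 doubleton_eq_iff)
    also have "\<dots> = of_bool ({a, b} \<in> F) + of_bool ({a, c} \<in> F) + of_bool ({b, c} \<in> F)"
      using fin by (simp add: sum.distrib of_bool_def del: add_bit_eq_xor)
    finally show ?thesis .
  qed
  have vF: "{v, a} \<notin> F" for a using FV by blast
  obtain a b where ab: "{a, b} \<in> F" "a \<noteq> b"
  proof -
    obtain e where "e \<in> F" using F(2) by blast
    moreover from this F(1) obtain a b where "e = {a, b}" "a \<noteq> b"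
      unfolding link_def nsets_2_eq by blast
    ultimately show thesis using that by blast
  qed
  have sub: "{T \<in> triples n. \<phi> (boundary_vec T) = 1} \<subseteq> C"
  proof
    fix T assume T: "T \<in> {T \<in> triples n. \<phi> (boundary_vec T) = 1}"
    show "T \<in> C"
    proof (cases "v \<in> T")
      case True
      have "card (T - {v}) = 2" using T True by (simp add: triples_def nsets_def)
      then obtain x y where "T - {v} = {x, y}" "x \<noteq> y" by (meson card_2_iff)
      then have xy: "T = {v, x, y}" "distinct [v, x, y]" using True by auto
      with T have "{x, y} \<in> F" using vF by (simp add: \<phi>T split: if_splits)
      then show ?thesis using F(1) xy unfolding link_def by auto
    next
      case False
      from T have "T \<subseteq> {1..n}" "card T = 3" by (auto simp: triples_def nsets_def)
      then obtain x y z where xyz: "T = {x, y, z}" "distinct [x, y, z]" "{x, y, z} \<subseteq> {1..n}"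
        unfolding card_3_iff by auto
      have odd: "({x, y} \<in> F) = (({x, z} \<in> F) = ({y, z} \<in> F))"
        using T unfolding xyz(1) by (simp only: \<phi>T[OF xyz(2)] odd_of_bool mem_Collect_eq)
      have e: "{y, x} = {x, y}" "{z, x} = {x, z}" "{z, y} = {y, z}" by auto
      \<comment> \<open>Three edges in \<open>F\<close> are three link edges. If only one edge is in
        \<open>F\<close>, there cannot be exactly two link edges: the second would be forced by the
        first across the non-edge and so lie in \<open>F\<close>.\<close>
      have "({x, y} \<in> link n v C) = (({x, z} \<in> link n v C) = ({y, z} \<in> link n v C))"
        using odd F(1) closed[of x y z] closed[of y x z] closed[of x z y] closed[of z x y]
          closed[of y z x] closed[of z y x] xyz(2)
        unfolding e distinct.simps list.set by blast
      then show ?thesis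
        using hypercut_cocycle[OF C, of v x y z] xyz v False by auto
    qed
  qed
  have "{v, a, b} \<in> triples n" "\<phi> (boundary_vec {v, a, b}) = 1"
    using FV[OF ab(1)] v ab vF by (auto simp: triples_iff \<phi>T)
  from hypercut_minimal[OF C add this sub] have C_eq: "C = {T \<in> triples n. \<phi> (boundary_vec T) = 1}" .
  have "link n v C \<subseteq> F"
  proof
    fix e assume "e \<in> link n v C"
    then obtain x y where "e = {x, y}" "distinct [v, x, y]" "{v, x, y} \<in> C"
      unfolding link_def nsets_2_eq by auto
    then show "e \<in> F" using vF C_eq by (auto simp: \<phi>T split: if_splits)
  qed
  with F(1) show ?thesis by blast
qed

section \<open>Sparse graphs whose complement is one forcing class\<close>

text \<open>The label classes stand in for components: starting from distinct labels, each edge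
  merges at most two classes, so it costs at most one label.\<close>

lemma exists_edge_constant_labelling:
  assumes "finite E" "finite U" and "\<And>e. e \<in> E \<Longrightarrow> card e = 2"
  shows "\<exists>f :: 'a \<Rightarrow> 'a. (\<forall>a b. {a, b} \<in> E \<longrightarrow> f a = f b) \<and> card U \<le> card (f ` U) + card E"
  using assms(1,3)
proof (induction E rule: finite_induct)
  case empty
  then show ?case by (intro exI[of _ id]) simp
next
  case (insert e E)
  then obtain f :: "'a \<Rightarrow> 'a"
    where f: "\<And>a b. {a, b} \<in> E \<Longrightarrow> f a = f b" "card U \<le> card (f ` U) + card E"
    by auto
  obtain x y where e: "e = {x, y}" using insert.prems[of e] by (auto simp: card_2_iff)
  define g where "g z = (if f z = f y then f x else f z)" for z
  have "f ` U \<subseteq> insert (f y) (g ` U)" unfolding g_def by auto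
  then have "card (f ` U) \<le> card (insert (f y) (g ` U))"
    using \<open>finite U\<close> by (intro card_mono) auto
  also have "\<dots> \<le> Suc (card (g ` U))" by (rule card_insert_le_m1) simp_all
  finally have "card U \<le> card (g ` U) + card (insert e E)" using f(2) insert.hyps by simp
  moreover have "g a = g b" if "{a, b} \<in> insert e E" for a b
    using that f(1) by (auto simp: g_def e doubleton_eq_iff)
  ultimately show ?case by blast
qed

section \<open>Degree sums and triples with exactly one edge\<close>

locale fin_graph =
  fixes V :: "'a set" and D :: "'a set set"
  assumes finite_V: "finite V" and D_subset: "D \<subseteq> nsets V 2"
begin

abbreviation nb :: "'a \<Rightarrow> 'a set" where
  "nb u \<equiv> {w. {u, w} \<in> D}"

lemma finite_D: "finite D"
  using D_subset finite_imp_finite_nsets[OF finite_V] finite_subset by blast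

lemma D_edge: "e \<in> D \<Longrightarrow> e \<subseteq> V \<and> card e = 2 \<and> finite e"
  using D_subset by (auto simp: nsets_def)

lemma D_pair: "{a, b} \<in> D \<Longrightarrow> a \<noteq> b \<and> a \<in> V \<and> b \<in> V"
  using D_edge[of "{a, b}"] by auto

lemma nb_subset: "nb u \<subseteq> V"
  using D_pair by auto

lemma finite_nb: "finite (nb u)"
  using nb_subset finite_V finite_subset by blast

lemma card_nb: "card (nb u) = degree D u"
proof -
  have "{e \<in> D. u \<in> e} = (\<lambda>w. {u, w}) ` nb u"
  proof -
    have "e \<in> (\<lambda>w. {u, w}) ` nb u" if "e \<in> D" "u \<in> e" for e
      using D_edge[OF that(1)] that by (auto simp: card_2_iff insert_commute)
    then show ?thesis by auto
  qed
  moreover have "inj_on (\<lambda>w. {u, w}) (nb u)"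
    by (auto simp: inj_on_def doubleton_eq_iff)
  ultimately show ?thesis by (simp add: degree_def card_image)
qed

text \<open>Weighted double counting of incidences: weight 1 gives the handshake identity, and the
  degree as weight gives the sum of squared degrees.\<close>

lemma sum_incidence: "(\<Sum>u\<in>S. degree D u * g u) = (\<Sum>e\<in>D. \<Sum>u\<in>e \<inter> S. g u)" if "S \<subseteq> V"
proof -
  have finS: "finite S" using that finite_V finite_subset by blast
  have "(\<Sum>u\<in>S. degree D u * g u) = (\<Sum>u\<in>S. \<Sum>e\<in>{e \<in> D. u \<in> e}. g u)"
    by (simp add: degree_def)
  also have "\<dots> = (\<Sum>e\<in>D. \<Sum>u\<in>{u \<in> S. u \<in> e}. g u)"
    by (rule sum.swap_restrict[OF finS finite_D])
  also have "\<dots> = (\<Sum>e\<in>D. \<Sum>u\<in>e \<inter> S. g u)"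
    by (rule sum.cong[OF refl], rule sum.cong) auto
  finally show ?thesis .
qed

lemma sum_degree: "(\<Sum>u\<in>V. degree D u) = 2 * card D"
  using sum_incidence[of V "\<lambda>_. 1"] D_edge by (simp add: Int_absorb2)

lemma degree_le: "degree D u \<le> card V"
  unfolding card_nb[symmetric] by (rule card_mono[OF finite_V nb_subset])

text \<open>An edge extends to such a triple by any vertex adjacent to neither end, which excludes
  at most the sum of the two end degrees. Over all edges these losses add up to the sum of squared
  degrees.\<close>

lemma card_one_edge_triples:
  "card D * card V \<le> card {T \<in> nsets V 3. \<exists>!e. e \<in> D \<and> e \<subseteq> T} + (\<Sum>u\<in>V. degree D u ^ 2)"
proof -
  define W where "W e = {w \<in> V. w \<notin> e \<and> (\<forall>u\<in>e. {u, w} \<notin> D)}" for e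
  define X where "X = Sigma D W"
  have finW: "finite (W e)" for e using finite_V by (simp add: W_def)
  have card_W: "card V \<le> card (W e) + (\<Sum>u\<in>e. degree D u)" if eD: "e \<in> D" for e
  proof -
    have "card e = 2" using D_edge[OF eD] by simp
    then obtain a b where e: "e = {a, b}" by (meson card_2_iff)
    \<comment> \<open>The ends of \<open>e\<close> are covered too, each being a neighbour of the
      other, so no correction by 2 arises.\<close>
    have "V \<subseteq> W e \<union> (\<Union>u\<in>e. nb u)"
      using eD unfolding e by (auto simp: W_def insert_commute)
    then have "card V \<le> card (W e \<union> (\<Union>u\<in>e. nb u))"
      using finW finite_nb D_edge[OF eD] by (intro card_mono) auto
    also have "\<dots> \<le> card (W e) + card (\<Union>u\<in>e. nb u)" by (rule card_Un_le)
    also have "card (\<Union>u\<in>e. nb u) \<le> (\<Sum>u\<in>e. card (nb u))"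
      using D_edge[OF eD] by (intro card_UN_le) auto
    finally show ?thesis by (simp add: card_nb)
  qed
  have only: "e' = e" if e: "(e, w) \<in> X" "e' \<in> D" "e' \<subseteq> insert w e" for e e' w
  proof (cases "w \<in> e'")
    case True
    moreover have "card e' = 2" using D_edge[OF e(2)] by simp
    ultimately obtain u where "e' = {u, w}" "u \<noteq> w"
      by (auto simp: card_2_iff insert_commute)
    then show ?thesis using e by (auto simp: X_def W_def)
  next
    case False
    then have "e' \<subseteq> e" using e(3) by blast
    moreover have "e \<in> D" using e(1) by (simp add: X_def)
    ultimately show ?thesis using D_edge[of e] D_edge[OF e(2)] by (simp add: card_subset_eq)
  qed
  have "inj_on (\<lambda>(e, w). insert w e) X"
  proof (rule inj_onI, clarify)
    fix e w e' w' assume X: "(e, w) \<in> X" "(e', w') \<in> X" and eq: "insert w e = insert w' e'"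
    have "e' \<in> D" "e' \<subseteq> insert w e" using X(2) eq by (auto simp: X_def)
    then have "e' = e" by (rule only[OF X(1)])
    moreover have "w \<notin> e" "w' \<notin> e'" using X by (auto simp: X_def W_def)
    ultimately show "e = e' \<and> w = w'" using eq by auto
  qed
  moreover have "(\<lambda>(e, w). insert w e) ` X \<subseteq> {T \<in> nsets V 3. \<exists>!e. e \<in> D \<and> e \<subseteq> T}"
  proof clarify
    fix e w assume X: "(e, w) \<in> X"
    then have e: "e \<in> D" "w \<in> V" "w \<notin> e" by (auto simp: X_def W_def)
    then have "insert w e \<in> nsets V 3" using D_edge[OF e(1)] by (auto simp: nsets_def)
    moreover have "\<exists>!e'. e' \<in> D \<and> e' \<subseteq> insert w e"
      using only[OF X] e(1) by (intro ex1I[of _ e]) auto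
    ultimately show "insert w e \<in> nsets V 3 \<and> (\<exists>!e'. e' \<in> D \<and> e' \<subseteq> insert w e)" by simp
  qed
  moreover have "finite {T \<in> nsets V 3. \<exists>!e. e \<in> D \<and> e \<subseteq> T}"
    using finite_imp_finite_nsets[OF finite_V] by simp
  ultimately have "card X \<le> card {T \<in> nsets V 3. \<exists>!e. e \<in> D \<and> e \<subseteq> T}" by (rule card_inj_on_le)
  moreover have "card D * card V \<le> card X + (\<Sum>u\<in>V. degree D u ^ 2)"
  proof -
    have "card D * card V = (\<Sum>e\<in>D. card V)" by simp
    also have "\<dots> \<le> (\<Sum>e\<in>D. card (W e) + (\<Sum>u\<in>e \<inter> V. degree D u))"
      using card_W D_edge by (intro sum_mono) (simp add: Int_absorb2)
    also have "\<dots> = card X + (\<Sum>u\<in>V. degree D u * degree D u)"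
      unfolding sum.distrib sum_incidence[OF order_refl] X_def
      using finite_D finW by (simp add: card_SigmaI)
    finally show ?thesis by (simp add: power2_eq_square)
  qed
  ultimately show ?thesis by simp
qed

text \<open>The degree sum over \<open>S\<close> counts an edge twice only if it lies inside
  \<open>S\<close>, and there are at most \<open>card S ^ 2\<close> such edges.\<close>

lemma sum_degree_subset:
  assumes "S \<subseteq> V"
  shows "(\<Sum>u\<in>S. degree D u) + card {e \<in> D. e \<subseteq> V - S} \<le> card D + card S ^ 2"
proof -
  have finS: "finite S" using assms finite_V finite_subset by blast
  have *: "card (e \<inter> S) + of_bool (e \<subseteq> V - S) \<le> 1 + of_bool (e \<subseteq> S)" if "e \<in> D" for e
  proof -
    have e: "e \<subseteq> V" "card e = 2" "finite e" using D_edge[OF that] by auto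
    show ?thesis
    proof (cases "e \<subseteq> S")
      case True
      moreover have "e \<noteq> {}" using e by auto
      ultimately have "\<not> e \<subseteq> V - S" by auto
      then show ?thesis using True e by (simp add: Int_absorb2)
    next
      case False
      then have "card (e \<inter> S) < card e" using e by (intro psubset_card_mono) auto
      moreover have "e \<inter> S = {}" if "e \<subseteq> V - S" using that by auto
      ultimately show ?thesis using e False by auto
    qed
  qed
  have "card {e \<in> D. e \<subseteq> S} \<le> card (nsets S 2)"
    using D_edge finite_imp_finite_nsets[OF finS] by (intro card_mono) (auto simp: nsets_def)
  also have "\<dots> \<le> card S ^ 2" using binomial_fact_pow[of "card S" 2] by simp
  finally have S2: "card {e \<in> D. e \<subseteq> S} \<le> card S ^ 2" .
  have "(\<Sum>u\<in>S. degree D u) + card {e \<in> D. e \<subseteq> V - S} = (\<Sum>e\<in>D. card (e \<inter> S) + of_bool (e \<subseteq> V - S))"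
    using sum_incidence[OF assms, of "\<lambda>_. 1"] finite_D
    by (simp add: sum.distrib of_bool_def sum.If_cases Int_def)
  also have "\<dots> \<le> (\<Sum>e\<in>D. 1 + of_bool (e \<subseteq> S))" using * by (rule sum_mono)
  also have "\<dots> = card D + card {e \<in> D. e \<subseteq> S}"
    using finite_D by (simp only: sum.distrib) (simp add: of_bool_def sum.If_cases Int_def)
  finally show ?thesis using S2 by simp
qed

end

text \<open>Here \<open>D\<close> plays the complement of a link. By \<open>sparse\<close>, its
  non-edges outnumber the edges of any complete bipartite graph on disjoint parts of
  \<open>V\<close>.\<close>

locale gallai_graph = fin_graph +
  assumes single_class: "\<And>F. \<lbrakk>F \<subseteq> nsets V 2 - D; F \<noteq> {};
      \<And>a b c. \<lbrakk>{a, b} \<in> F; {b, c} \<in> nsets V 2 - D; {a, c} \<in> D\<rbrakk> \<Longrightarrow> {b, c} \<in> F\<rbrakk>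
      \<Longrightarrow> F = nsets V 2 - D"
    and sparse: "real (card D) + real (card V) ^ 2 / 4 < real (card V choose 2)"
begin

text \<open>The pairs between \<open>A\<close> and \<open>B\<close> would be a forcing class of non-edges, and \<open>D\<close> is too sparse
  to contain all other pairs.\<close>

lemma no_equal_constant_traces:
  assumes S: "S \<subseteq> V" and AB: "A \<subseteq> V - S" "B \<subseteq> V - S" "A \<inter> B = {}" "A \<noteq> {}" "B \<noteq> {}"
    and A: "\<And>a c. a \<in> A \<Longrightarrow> c \<in> V - S \<Longrightarrow> {a, c} \<in> D \<Longrightarrow> c \<in> A"
    and B: "\<And>a c. a \<in> B \<Longrightarrow> c \<in> V - S \<Longrightarrow> {a, c} \<in> D \<Longrightarrow> c \<in> B"
    and tr: "\<And>x i. x \<in> A \<union> B \<Longrightarrow> i \<in> S \<Longrightarrow> {x, i} \<in> D \<longleftrightarrow> i \<in> T"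
  shows False
proof -
  define F where "F = (\<lambda>(a, b). {a, b}) ` (A \<times> B)"
  have F_iff: "{a, b} \<in> F \<longleftrightarrow> a \<in> A \<and> b \<in> B \<or> a \<in> B \<and> b \<in> A" for a b
    by (auto simp: F_def image_iff doubleton_eq_iff)
  have fin: "finite A" "finite B" using AB finite_V by (auto intro: finite_subset)
  have "F = nsets V 2 - D"
  proof (rule single_class)
    show "F \<subseteq> nsets V 2 - D"
    proof clarify
      fix e assume "e \<in> F"
      then obtain a b where e: "e = {a, b}" "a \<in> A" "b \<in> B" by (auto simp: F_def)
      then have "a \<noteq> b" "a \<in> V - S" "b \<in> V - S" "b \<notin> A" using AB by auto
      then show "e \<in> nsets V 2 - D" using A[of a b] e by (auto simp: nsets_def)
    qed
    show "F \<noteq> {}" using AB by (auto simp: F_def)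
    fix a b c assume ab: "{a, b} \<in> F" and bc: "{b, c} \<in> nsets V 2 - D" and ac: "{a, c} \<in> D"
    have c: "c \<in> V" using D_pair[OF ac] by simp
    have ab': "a \<in> A \<union> B" "b \<in> A \<union> B" using ab by (auto simp: F_iff)
    \<comment> \<open>A vertex of \<open>S\<close> sees all of \<open>A\<close> and \<open>B\<close>
      alike, so it cannot be adjacent to \<open>a\<close> but not to \<open>b\<close>.\<close>
    have "c \<notin> S" using tr[OF ab'(1), of c] tr[OF ab'(2), of c] bc ac by auto
    then show "{b, c} \<in> F" using ab A[of a c] B[of a c] c ac by (auto simp: F_iff)
  qed
  then have "nsets V 2 \<subseteq> D \<union> F" by blast
  then have "card (nsets V 2) \<le> card (D \<union> F)"
    using finite_D fin by (intro card_mono) (auto simp: F_def)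
  also have "\<dots> \<le> card D + card F" by (rule card_Un_le)
  also have "card F \<le> card A * card B"
    unfolding F_def using card_image_le[of "A \<times> B"] fin by (simp add: card_cartesian_product)
  finally have 1: "card V choose 2 \<le> card D + card A * card B" by simp
  have "card A + card B = card (A \<union> B)" using AB fin by (simp add: card_Un_disjoint)
  also have "\<dots> \<le> card V" using AB finite_V by (intro card_mono) auto
  finally have "(real (card A) + real (card B)) ^ 2 \<le> real (card V) ^ 2" by (intro power_mono) auto
  moreover have "4 * (real (card A) * real (card B)) \<le> (real (card A) + real (card B)) ^ 2"
    using zero_le_power2[of "real (card A) - real (card B)"]
    by (simp add: power2_eq_square algebra_simps)
  ultimately have "real (card A * card B) \<le> real (card V) ^ 2 / 4" unfolding of_nat_mult by linarith
  moreover have "real (card V choose 2) \<le> real (card D + card A * card B)" using 1 by (rule of_nat_mono)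
  ultimately show False using sparse unfolding of_nat_add by linarith
qed

text \<open>\<open>q\<close> is the number of classes of a partition of \<open>V - S\<close> into unions of components, and \<open>b i\<close> is the
  number of classes containing both a neighbour and a non-neighbour of \<open>i\<close>. At most one class can
  have any given constant trace on \<open>S\<close>, so all but \<open>2 ^ card S\<close> classes are counted by some \<open>b i\<close>
  and have at least two vertices.\<close>

lemma structure_at_subset:
  assumes S: "S \<subseteq> V"
  obtains q b where
    "card V + (\<Sum>i\<in>S. degree D i) \<le> card D + q + card S + card S ^ 2"
    "2 * q \<le> card V + 2 ^ card S"
    "q \<le> (\<Sum>i\<in>S. b i) + 2 ^ card S"
    "\<And>i. b i \<le> q" "\<And>i. b i \<le> degree D i" "\<And>i. b i + degree D i \<le> card V"
proof -
  define U where "U = V - S"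
  have finS: "finite S" and finU: "finite U"
    using S finite_V finite_subset by (auto simp: U_def)
  let ?E = "{e \<in> D. e \<subseteq> U}"
  obtain f :: "'a \<Rightarrow> 'a" where f: "\<And>a b. {a, b} \<in> ?E \<Longrightarrow> f a = f b"
    and card_f: "card U \<le> card (f ` U) + card ?E"
    using exists_edge_constant_labelling[of ?E U] finite_D finU D_edge by auto
  define L where "L = f ` U"
  define tr where "tr l = {i \<in> S. \<exists>x\<in>U. f x = l \<and> {x, i} \<in> D}" for l
  define Li where "Li i = {l \<in> L. (\<exists>x\<in>U. f x = l \<and> {x, i} \<in> D) \<and> (\<exists>x\<in>U. f x = l \<and> {x, i} \<notin> D)}" for i
  define Lc where "Lc = L - (\<Union>i\<in>S. Li i)"
  have finL: "finite L" using finU by (simp add: L_def)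
  have Lc_tr: "{x, i} \<in> D \<longleftrightarrow> i \<in> tr l" if "l \<in> Lc" "x \<in> U" "f x = l" "i \<in> S" for l x i
    using that by (auto simp: Lc_def Li_def tr_def)
  have "inj_on tr Lc"
  proof (rule inj_onI, rule ccontr)
    fix l l' assume l: "l \<in> Lc" "l' \<in> Lc" "tr l = tr l'" "l \<noteq> l'"
    let ?A = "{x \<in> U. f x = l}" and ?B = "{x \<in> U. f x = l'}"
    have ne: "?A \<noteq> {}" "?B \<noteq> {}" using l by (auto simp: Lc_def L_def)
    have closed: "c \<in> {x \<in> U. f x = m}" if "a \<in> {x \<in> U. f x = m}" "c \<in> V - S" "{a, c} \<in> D" for a c m
      using that f[of a c] by (simp add: U_def)
    have "{x, i} \<in> D \<longleftrightarrow> i \<in> tr l" if "x \<in> ?A \<union> ?B" "i \<in> S" for x i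
      using that Lc_tr[OF l(1)] Lc_tr[OF l(2)] l(3) by blast
    moreover have "?A \<subseteq> V - S" "?B \<subseteq> V - S" "?A \<inter> ?B = {}" using l(4) by (auto simp: U_def)
    ultimately show False
      by (intro no_equal_constant_traces[OF S _ _ _ ne closed closed]) assumption+
  qed
  then have card_Lc: "card Lc \<le> 2 ^ card S"
    using card_inj_on_le[of tr Lc "Pow S"] finS by (auto simp: tr_def card_Pow)
  have "L \<subseteq> (\<Union>i\<in>S. Li i) \<union> Lc" by (auto simp: Lc_def)
  then have "card L \<le> card ((\<Union>i\<in>S. Li i) \<union> Lc)"
    using finS finL by (intro card_mono) (auto simp: Lc_def Li_def)
  also have "\<dots> \<le> card (\<Union>i\<in>S. Li i) + card Lc" by (rule card_Un_le)
  also have "card (\<Union>i\<in>S. Li i) \<le> (\<Sum>i\<in>S. card (Li i))" by (rule card_UN_le[OF finS])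
  finally have q_le: "card L \<le> (\<Sum>i\<in>S. card (Li i)) + 2 ^ card S" using card_Lc by simp
  \<comment> \<open>A split class contains a neighbour and a non-neighbour, hence two vertices; the
    summand \<open>of_bool\<close> compensates for constant classes that are singletons.\<close>
  have fiber: "2 \<le> card {x \<in> U. f x = l} + of_bool (l \<in> Lc)" if l: "l \<in> L" for l
  proof (cases "l \<in> Lc")
    case True
    then have "{x \<in> U. f x = l} \<noteq> {}" using l by (auto simp: L_def)
    then have "card {x \<in> U. f x = l} > 0" using finU by (simp add: card_gt_0_iff)
    then show ?thesis using True by simp
  next
    case False
    then obtain i x y where "x \<in> U" "y \<in> U" "f x = l" "f y = l" "{x, i} \<in> D" "{y, i} \<notin> D"
      using l by (auto simp: Lc_def Li_def)
    then have "{x, y} \<subseteq> {x \<in> U. f x = l}" "x \<noteq> y" by auto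
    then have "card {x, y} \<le> card {x \<in> U. f x = l}" using finU by (intro card_mono) auto
    then show ?thesis using \<open>x \<noteq> y\<close> by simp
  qed
  have "2 * card L = (\<Sum>l\<in>L. 2)" by simp
  also have "\<dots> \<le> (\<Sum>l\<in>L. card {x \<in> U. f x = l} + of_bool (l \<in> Lc))" using fiber by (rule sum_mono)
  also have "\<dots> = card U + card Lc"
  proof -
    have "(\<Sum>l\<in>L. card {x \<in> U. f x = l}) = card U"
      unfolding L_def card_eq_sum sum.image_gen[OF finU, of "\<lambda>_. 1" f] ..
    moreover have "(\<Sum>l\<in>L. of_bool (l \<in> Lc)) = card Lc"
    proof -
      have "L \<inter> {l. l \<in> Lc} = Lc" by (auto simp: Lc_def)
      then show ?thesis using finL by (simp add: of_bool_def sum.If_cases)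
    qed
    ultimately show ?thesis by (simp add: sum.distrib)
  qed
  finally have 2: "2 * card L \<le> card V + 2 ^ card S"
    using card_Lc card_mono[OF finite_V, of U] by (simp add: U_def)
  have "card U = card V - card S" using S finS by (simp add: U_def card_Diff_subset)
  then have 1: "card V + (\<Sum>i\<in>S. degree D i) \<le> card D + card L + card S + card S ^ 2"
    using sum_degree_subset[OF S] card_f by (simp add: U_def L_def)
  have 3: "card (Li i) \<le> card L" for i using finL by (intro card_mono) (auto simp: Li_def)
  \<comment> \<open>Each class split by \<open>i\<close> contains a neighbour of \<open>i\<close>,
    and below also a non-neighbour; distinct classes use distinct vertices.\<close>
  have 4: "card (Li i) \<le> degree D i" for i
  proof -
    have "Li i \<subseteq> f ` nb i"
    proof
      fix l assume "l \<in> Li i"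
      then obtain x where "f x = l" "{x, i} \<in> D" by (auto simp: Li_def)
      moreover from this have "x \<in> nb i" by (simp add: insert_commute)
      ultimately show "l \<in> f ` nb i" by blast
    qed
    then have "card (Li i) \<le> card (f ` nb i)" by (rule card_mono[OF finite_imageI[OF finite_nb]])
    also have "\<dots> \<le> degree D i" unfolding card_nb[symmetric] by (rule card_image_le[OF finite_nb])
    finally show ?thesis .
  qed
  have 5: "card (Li i) + degree D i \<le> card V" for i
  proof -
    have "Li i \<subseteq> f ` (V - nb i)"
    proof
      fix l assume "l \<in> Li i"
      then obtain x where "x \<in> U" "f x = l" "{x, i} \<notin> D" by (auto simp: Li_def)
      moreover from this have "x \<in> V - nb i" by (simp add: insert_commute U_def)
      ultimately show "l \<in> f ` (V - nb i)" by blast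
    qed
    then have "card (Li i) \<le> card (f ` (V - nb i))" using finite_V by (intro card_mono) auto
    also have "\<dots> \<le> card (V - nb i)" using finite_V by (intro card_image_le) simp
    also have "\<dots> = card V - degree D i"
      using nb_subset finite_nb by (simp add: card_Diff_subset card_nb)
    finally show ?thesis using degree_le[of i] by simp
  qed
  from that[OF 1 2 q_le 3 4 5] show thesis .
qed

end

section \<open>The optimisation problem\<close>

text \<open>The setting below, divided by \<open>n\<close>: \<open>\<delta>\<close> are the large degrees, \<open>\<mu>\<close> the number of edges of the
  complement \<open>D\<close> of the link, \<open>\<kappa>\<close> and \<open>\<beta>\<close> the numbers \<open>q\<close> and \<open>b\<close> of \<open>structure_at_subset\<close>, and
  \<open>\<gamma> n\<^sup>2\<close> the number of triples outside the hypercut.\<close>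

locale degree_weights =
  fixes S :: "'a set" and \<delta> \<beta> :: "'a \<Rightarrow> real" and \<gamma> \<mu> \<kappa> \<epsilon> :: real
  assumes finite_S: "finite S" and \<epsilon>: "0 < \<epsilon>" "\<epsilon> \<le> 1 / 200"
    and \<gamma>: "\<mu> - (\<Sum>i\<in>S. (\<delta> i)\<^sup>2) - \<epsilon> \<le> \<gamma>"
    and \<mu>: "1 - \<kappa> + (\<Sum>i\<in>S. \<delta> i) - \<epsilon> \<le> \<mu>"
    and \<beta>: "\<And>i. 0 \<le> \<beta> i" "\<And>i. \<beta> i \<le> \<kappa>" "\<And>i. \<beta> i \<le> \<delta> i" "\<And>i. \<beta> i + \<delta> i \<le> 1"
    and sum_\<beta>: "\<kappa> - \<epsilon> \<le> (\<Sum>i\<in>S. \<beta> i)"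
    and \<kappa>: "\<kappa> \<le> 1 / 2 + \<epsilon>"
begin

text \<open>The bounds on \<open>\<beta>\<close> hold at every index, so an arbitrary one serves
  even if \<open>S\<close> is empty.\<close>

lemma \<kappa>_nonneg: "0 \<le> \<kappa>"
  using \<beta>(1,2)[of undefined] by linarith

lemma \<delta>_bounds: "0 \<le> \<delta> i" "\<delta> i \<le> 1"
  using \<beta>(1,3,4)[of i] by linarith+

text \<open>The function \<open>x * (1 - x)\<close> is concave and symmetric about 1/2, and
  \<open>\<delta> i\<close> lies between \<open>\<beta> i\<close> and
  \<open>1 - \<beta> i\<close>.\<close>

lemma \<beta>_\<delta>: "\<beta> i * (1 - \<beta> i) \<le> \<delta> i * (1 - \<delta> i)"
proof -
  have "0 \<le> (\<delta> i - \<beta> i) * (1 - \<beta> i - \<delta> i)" using \<beta>[of i] by (intro mult_nonneg_nonneg) auto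
  then show ?thesis by (simp add: algebra_simps)
qed

text \<open>It measures how far the normalised degrees are from being all 0 or 1, and is what
  remains of their sum after subtracting their squares.\<close>

definition spread :: real where "spread = (\<Sum>i\<in>S. \<delta> i * (1 - \<delta> i))"

lemma sum_\<delta>_square: "(\<Sum>i\<in>S. (\<delta> i)\<^sup>2) = (\<Sum>i\<in>S. \<delta> i) - spread"
  by (simp add: spread_def sum_subtractf[symmetric] power2_eq_square algebra_simps)

lemma \<gamma>_ge: "1 - \<kappa> + spread - 2 * \<epsilon> \<le> \<gamma>"
  using \<gamma> \<mu> sum_\<delta>_square by linarith

lemma sum_\<beta>_le_spread: "(\<Sum>i\<in>S. \<beta> i * (1 - \<beta> i)) \<le> spread"
  unfolding spread_def by (rule sum_mono) (rule \<beta>_\<delta>)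

text \<open>As \<open>\<beta> i \<le> \<kappa>\<close>, every factor \<open>1 - \<beta> i\<close> is
  at least \<open>1 - \<kappa>\<close>.\<close>

lemma spread_ge: "(1 - \<kappa>) * (\<kappa> - \<epsilon>) \<le> spread"
proof -
  have "(1 - \<kappa>) * (\<kappa> - \<epsilon>) \<le> (1 - \<kappa>) * (\<Sum>i\<in>S. \<beta> i)"
    using sum_\<beta> \<kappa> \<epsilon> by (intro mult_left_mono) auto
  also have "\<dots> = (\<Sum>i\<in>S. \<beta> i * (1 - \<kappa>))" by (simp add: sum_distrib_left mult.commute)
  also have "\<dots> \<le> (\<Sum>i\<in>S. \<beta> i * (1 - \<beta> i))"
    using \<beta> by (intro sum_mono mult_left_mono) auto
  also note sum_\<beta>_le_spread
  finally show ?thesis .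
qed

lemma \<gamma>_ge_\<kappa>: "1 - \<kappa>\<^sup>2 - 3 * \<epsilon> \<le> \<gamma>"
proof -
  have "0 \<le> \<kappa> * \<epsilon>" using \<kappa>_nonneg \<epsilon> by simp
  then have "\<kappa> - \<kappa>\<^sup>2 - \<epsilon> \<le> spread" using spread_ge by (simp add: power2_eq_square algebra_simps)
  then show ?thesis using \<gamma>_ge by linarith
qed

lemma \<epsilon>_square: "\<epsilon>\<^sup>2 \<le> \<epsilon> / 200"
  using mult_left_mono[OF \<epsilon>(2), of \<epsilon>] \<epsilon> by (simp add: power2_eq_square)

lemma lower_bound: "3 / 4 - 5 * \<epsilon> \<le> \<gamma>"
proof -
  have "\<kappa>\<^sup>2 \<le> (1 / 2 + \<epsilon>)\<^sup>2" using \<kappa> \<kappa>_nonneg by (intro power_mono) auto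
  then have "\<kappa>\<^sup>2 \<le> 1 / 4 + \<epsilon> + \<epsilon>\<^sup>2" by (simp add: power2_eq_square algebra_simps)
  then show ?thesis using \<gamma>_ge_\<kappa> \<epsilon>_square \<epsilon> by linarith
qed

text \<open>Near equality makes \<open>\<kappa>\<close>, and then one \<open>\<beta> y\<close>,
  close to 1/2. This \<open>y\<close> uses up almost all of \<open>spread\<close>, so the other
  degrees are close to 0 or 1, and \<open>\<mu>\<close> tells how many are close to 1.\<close>

lemma near_extremal:
  assumes \<gamma>_le: "\<gamma> \<le> 3 / 4 + \<epsilon>" and \<mu>_le: "\<mu> \<le> 3 * \<gamma>"
  shows "\<exists>y\<in>S. \<bar>\<delta> y - 1 / 2\<bar> \<le> 200 * \<epsilon> \<and>
    ((\<forall>i\<in>S - {y}. \<delta> i \<le> 200 * \<epsilon>) \<and> \<bar>\<mu> - 1\<bar> \<le> 200 * \<epsilon> \<or>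
     (\<exists>x\<in>S - {y}. \<bar>\<delta> x - 1\<bar> \<le> 200 * \<epsilon> \<and> (\<forall>i\<in>S - {x, y}. \<delta> i \<le> 200 * \<epsilon>) \<and> \<bar>\<mu> - 2\<bar> \<le> 200 * \<epsilon>))"
proof -
  have \<kappa>_ge: "1 / 2 - 8 * \<epsilon> \<le> \<kappa>"
  proof (rule power2_le_imp_le[OF _ \<kappa>_nonneg])
    have "(1 / 2 - 8 * \<epsilon>)\<^sup>2 = 1 / 4 - 8 * \<epsilon> + 64 * \<epsilon>\<^sup>2" by (simp add: power2_eq_square algebra_simps)
    then show "(1 / 2 - 8 * \<epsilon>)\<^sup>2 \<le> \<kappa>\<^sup>2" using \<gamma>_ge_\<kappa> \<gamma>_le \<epsilon>_square \<epsilon> by linarith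
  qed
  have spread_le: "spread \<le> 1 / 4 + 4 * \<epsilon>" using \<gamma>_ge \<gamma>_le \<kappa> by linarith
  \<comment> \<open>If all were smaller, the larger factors \<open>1 - \<beta> i\<close> would push
    \<open>spread\<close> above its upper bound; 40 leaves room for the error in
    \<open>\<kappa>\<close> and the quadratic term.\<close>
  have "\<exists>y\<in>S. 1 / 2 - 40 * \<epsilon> \<le> \<beta> y"
  proof (rule ccontr)
    assume "\<not> ?thesis"
    then have small: "\<And>i. i \<in> S \<Longrightarrow> 1 / 2 + 40 * \<epsilon> \<le> 1 - \<beta> i" by fastforce
    have "(1 / 2 + 40 * \<epsilon>) * (1 / 2 - 9 * \<epsilon>) \<le> (1 / 2 + 40 * \<epsilon>) * (\<Sum>i\<in>S. \<beta> i)"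
      using sum_\<beta> \<kappa>_ge \<epsilon> by (intro mult_left_mono) auto
    also have "\<dots> = (\<Sum>i\<in>S. \<beta> i * (1 / 2 + 40 * \<epsilon>))"
      unfolding sum_distrib_right[symmetric] by (rule mult.commute)
    also have "\<dots> \<le> (\<Sum>i\<in>S. \<beta> i * (1 - \<beta> i))"
      using small \<beta>(1) by (intro sum_mono mult_left_mono)
    also have "\<dots> \<le> 1 / 4 + 4 * \<epsilon>" using sum_\<beta>_le_spread spread_le by linarith
    finally have "(1 / 2 + 40 * \<epsilon>) * (1 / 2 - 9 * \<epsilon>) \<le> 1 / 4 + 4 * \<epsilon>" .
    moreover have "(1 / 2 + 40 * \<epsilon>) * (1 / 2 - 9 * \<epsilon>) = 1 / 4 + 31 / 2 * \<epsilon> - 360 * \<epsilon>\<^sup>2"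
      by (simp add: power2_eq_square algebra_simps)
    ultimately show False using \<epsilon>_square \<epsilon> by linarith
  qed
  then obtain y where y: "y \<in> S" "1 / 2 - 40 * \<epsilon> \<le> \<beta> y" by blast
  have \<delta>y: "1 / 2 - 40 * \<epsilon> \<le> \<delta> y" "\<delta> y \<le> 1 / 2 + 40 * \<epsilon>" using y \<beta>(3,4)[of y] by linarith+
  have "(1 / 2 - \<delta> y)\<^sup>2 \<le> (40 * \<epsilon>)\<^sup>2" using \<delta>y by (intro power2_le_iff_abs_le[THEN iffD2]) (use \<epsilon> in auto)
  moreover have "(1 / 2 - \<delta> y)\<^sup>2 = 1 / 4 - \<delta> y * (1 - \<delta> y)" "(40 * \<epsilon>)\<^sup>2 = 1600 * \<epsilon>\<^sup>2"
    by (simp_all add: power2_eq_square algebra_simps)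
  ultimately have \<delta>y2: "1 / 4 - 40 * \<epsilon> \<le> \<delta> y * (1 - \<delta> y)" using \<epsilon>_square \<epsilon> by linarith
  define R where "R = S - {y}"
  define J where "J = {i \<in> R. 1 / 2 < \<delta> i}"
  have finR: "finite R" "finite J" using finite_S by (auto simp: R_def J_def)
  have split: "(\<Sum>i\<in>S. g i) = g y + (\<Sum>i\<in>R. g i)" for g :: "'a \<Rightarrow> real"
    unfolding R_def by (rule sum.remove[OF finite_S y(1)])
  define T where "T = (\<Sum>i\<in>R. \<delta> i * (1 - \<delta> i))"
  have T: "T \<le> 44 * \<epsilon>" using spread_le \<delta>y2 unfolding spread_def T_def split by linarith
  \<comment> \<open>On the unit interval, \<open>x * (1 - x)\<close> is at least half the distance
    to the nearer end point. So the small total \<open>T\<close> controls both single deviations and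
    their sum.\<close>
  have half: "(\<bar>\<delta> i - of_bool (i \<in> J)\<bar>) \<le> 2 * (\<delta> i * (1 - \<delta> i))" if "i \<in> R" for i
  proof (cases "i \<in> J")
    case True
    then have "0 \<le> (1 - \<delta> i) * (2 * \<delta> i - 1)" using \<delta>_bounds by (intro mult_nonneg_nonneg) (auto simp: J_def)
    then show ?thesis using True \<delta>_bounds[of i] by (simp add: algebra_simps)
  next
    case False
    then have "0 \<le> \<delta> i * (1 - 2 * \<delta> i)" using \<delta>_bounds that by (intro mult_nonneg_nonneg) (auto simp: J_def)
    then show ?thesis using False \<delta>_bounds[of i] by (simp add: algebra_simps)
  qed
  have pointwise: "\<bar>\<delta> i - of_bool (i \<in> J)\<bar> \<le> 88 * \<epsilon>" if "i \<in> R" for i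
  proof -
    have "\<delta> i * (1 - \<delta> i) \<le> T"
      unfolding T_def using \<delta>_bounds finR that by (intro member_le_sum) auto
    then show ?thesis using half[OF that] T by linarith
  qed
  have "\<bar>(\<Sum>i\<in>R. \<delta> i) - card J\<bar> = \<bar>\<Sum>i\<in>R. \<delta> i - of_bool (i \<in> J)\<bar>"
  proof -
    have "R \<inter> {i. i \<in> J} = J" by (auto simp: J_def)
    then show ?thesis using finR by (simp add: sum_subtractf of_bool_def sum.If_cases)
  qed
  also have "\<dots> \<le> (\<Sum>i\<in>R. \<bar>\<delta> i - of_bool (i \<in> J)\<bar>)" by (rule sum_abs)
  also have "\<dots> \<le> (\<Sum>i\<in>R. 2 * (\<delta> i * (1 - \<delta> i)))" using half by (rule sum_mono)
  also have "\<dots> = 2 * T" by (simp add: T_def sum_distrib_left)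
  finally have J: "\<bar>(\<Sum>i\<in>R. \<delta> i) - card J\<bar> \<le> 88 * \<epsilon>" using T by linarith
  have \<mu>_lower: "1 + card J - 130 * \<epsilon> \<le> \<mu>"
    using \<mu> \<kappa> \<delta>y J unfolding split by linarith
  have "T \<ge> 0" unfolding T_def using \<delta>_bounds by (intro sum_nonneg) auto
  then have "(\<Sum>i\<in>S. (\<delta> i)\<^sup>2) \<le> \<delta> y + (\<Sum>i\<in>R. \<delta> i) - \<delta> y * (1 - \<delta> y)"
    unfolding sum_\<delta>_square spread_def split T_def by linarith
  then have \<mu>_upper: "\<mu> \<le> 1 + card J + 200 * \<epsilon>"
    using \<gamma> \<gamma>_le \<delta>y \<delta>y2 J by linarith
  \<comment> \<open>Two elements of \<open>J\<close> would give
    \<open>\<mu> \<ge> 3 - 130 * \<epsilon>\<close>, against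
    \<open>\<mu> \<le> 3 * \<gamma> \<le> 9 / 4 + 3 * \<epsilon>\<close>.\<close>
  have "real (card J) < 2" using \<mu>_lower \<mu>_le \<gamma>_le \<epsilon> by linarith
  then have "card J = 0 \<or> card J = 1" by linarith
  then show ?thesis
  proof
    assume "card J = 0"
    then have "J = {}" "\<bar>\<mu> - 1\<bar> \<le> 200 * \<epsilon>" using finR \<mu>_lower \<mu>_upper \<epsilon> by auto
    moreover have "\<delta> i \<le> 200 * \<epsilon>" if "i \<in> S - {y}" for i
      using pointwise[of i] that \<open>J = {}\<close> \<epsilon> by (simp add: R_def)
    ultimately show ?thesis using y(1) \<delta>y \<epsilon> by (intro bexI[of _ y]) auto
  next
    assume J1: "card J = 1"
    then obtain x where Jx: "J = {x}" by (meson card_1_singletonE)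
    then have x: "x \<in> S - {y}" by (auto simp: J_def R_def)
    have "\<bar>\<mu> - 2\<bar> \<le> 200 * \<epsilon>" using J1 \<mu>_lower \<mu>_upper \<epsilon> by auto
    moreover have "\<bar>\<delta> x - 1\<bar> \<le> 200 * \<epsilon>" using pointwise[of x] x Jx \<epsilon> by (simp add: R_def)
    moreover have "\<delta> i \<le> 200 * \<epsilon>" if "i \<in> S - {x, y}" for i
      using pointwise[of i] that Jx \<epsilon> by (simp add: R_def)
    ultimately show ?thesis using y(1) x \<delta>y \<epsilon> by (intro bexI[of _ y] conjI disjI2 bexI[of _ x]) auto
  qed
qed

end

section \<open>Large hypercuts\<close>

lemma finite_triples: "finite (triples n)"
  unfolding triples_def by (simp add: finite_imp_finite_nsets)

lemma complement_link:
  "complement_graph ({1..n} - {v}) (link n v C) = {e \<in> nsets ({1..n} - {v}) 2. insert v e \<notin> C}"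
  by (auto simp: complement_graph_def link_def)

lemma card_complement_link:
  assumes "v \<in> {1..n}"
  shows "card (complement_graph ({1..n} - {v}) (link n v C)) = card {T \<in> triples n - C. v \<in> T}"
  unfolding complement_link
proof (rule bij_betw_same_card)
  let ?D = "{e \<in> nsets ({1..n} - {v}) 2. insert v e \<notin> C}"
  show "bij_betw (insert v) ?D {T \<in> triples n - C. v \<in> T}"
  proof (rule bij_betwI[where g = "\<lambda>T. T - {v}"])
    show "insert v \<in> ?D \<rightarrow> {T \<in> triples n - C. v \<in> T}"
      using assms by (auto simp: triples_def nsets_def card_insert_if)
    show "(\<lambda>T. T - {v}) \<in> {T \<in> triples n - C. v \<in> T} \<rightarrow> ?D"
      by (auto simp: triples_def nsets_def insert_absorb)
  qed (auto simp: nsets_def)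
qed

text \<open>Averaging over the vertices: every missing triple is counted at each of its three
  vertices.\<close>

lemma exists_sparse_complement_link:
  assumes "0 < n"
  shows "\<exists>v\<in>{1..n}. n * card (complement_graph ({1..n} - {v}) (link n v C)) \<le> 3 * card (triples n - C)"
proof (rule ccontr)
  let ?m = "\<lambda>v. card (complement_graph ({1..n} - {v}) (link n v C))" and ?X = "triples n - C"
  assume "\<not> ?thesis"
  then have "3 * card ?X < n * ?m v" if "v \<in> {1..n}" for v using that by (meson not_le)
  then have "(\<Sum>v\<in>{1..n}. 3 * card ?X) < (\<Sum>v\<in>{1..n}. n * ?m v)"
    using assms by (intro sum_strict_mono) simp_all
  moreover have "(\<Sum>v\<in>{1..n}. ?m v) = 3 * card ?X"
  proof -
    have "(\<Sum>v\<in>{1..n}. ?m v) = (\<Sum>v\<in>{1..n}. \<Sum>T\<in>{T \<in> ?X. v \<in> T}. 1)"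
      by (intro sum.cong refl) (subst card_complement_link, simp_all)
    also have "\<dots> = (\<Sum>T\<in>?X. \<Sum>v\<in>{v \<in> {1..n}. v \<in> T}. 1)"
      using finite_triples by (intro sum.swap_restrict) auto
    also have "\<dots> = (\<Sum>T\<in>?X. 3)"
    proof (rule sum.cong[OF refl])
      fix T assume "T \<in> ?X"
      then have "{v \<in> {1..n}. v \<in> T} = T" "card T = 3" by (auto simp: triples_def nsets_def)
      then show "(\<Sum>v\<in>{v \<in> {1..n}. v \<in> T}. 1) = (3 :: nat)" by simp
    qed
    finally show ?thesis by simp
  qed
  ultimately show False by (simp add: sum_distrib_left[symmetric])
qed

lemma fin_graph_complement_link: "fin_graph ({1..n} - {v}) (complement_graph ({1..n} - {v}) (link n v C))"
  by unfold_locales (auto simp: complement_graph_def)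

text \<open>A triple avoiding \<open>v\<close> with exactly one edge of \<open>D\<close> has two
  link edges, an even number, so it is missing from \<open>C\<close>. The missing triples through
  \<open>v\<close> add \<open>card D\<close>, which turns the factor \<open>card V = n - 1\<close>
  into \<open>n\<close>.\<close>

lemma card_complement_hypercut_ge:
  assumes C: "hypercut n C" and v: "v \<in> {1..n}"
  defines "V \<equiv> {1..n} - {v}"
  defines "D \<equiv> complement_graph V (link n v C)"
  shows "n * card D \<le> card (triples n - C) + (\<Sum>u\<in>V. degree D u ^ 2)"
proof -
  interpret fin_graph V D unfolding V_def D_def by (rule fin_graph_complement_link)
  define O1 where "O1 = {T \<in> nsets V 3. \<exists>!e. e \<in> D \<and> e \<subseteq> T}"
  have O1: "T \<in> triples n - C - {T. v \<in> T}" if "T \<in> O1" for T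
  proof -
    from that have T: "T \<subseteq> V" "card T = 3" and ex1: "\<exists>!e. e \<in> D \<and> e \<subseteq> T"
      by (auto simp: O1_def nsets_def)
    from T(2) obtain a b c where abc: "T = {a, b, c}" "distinct [a, b, c]"
      unfolding card_3_iff by auto
    have vV: "distinct [v, a, b, c]" "{v, a, b, c} \<subseteq> {1..n}"
      using T(1) abc v by (auto simp: V_def)
    have D_link: "{x, y} \<in> link n v C \<longleftrightarrow> {x, y} \<notin> D" if "x \<in> T" "y \<in> T" "x \<noteq> y" for x y
      using that T(1) by (auto simp: D_def complement_graph_def link_def nsets_def V_def)
    have neq: "{a, b} \<noteq> {a, c}" "{a, b} \<noteq> {b, c}" "{a, c} \<noteq> {b, c}"
      using abc(2) by (auto simp: doubleton_eq_iff)
    obtain e where e: "e \<in> D" "e \<subseteq> T" using ex1 by blast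
    have "e = {a, b} \<or> e = {a, c} \<or> e = {b, c}"
      using D_edge[OF e(1)] e(2) abc by (auto simp: card_2_iff)
    moreover have "{a, b} \<subseteq> T" "{a, c} \<subseteq> T" "{b, c} \<subseteq> T" using abc(1) by auto
    then have "\<not> ({a, b} \<in> D \<and> {a, c} \<in> D)" "\<not> ({a, b} \<in> D \<and> {b, c} \<in> D)"
      "\<not> ({a, c} \<in> D \<and> {b, c} \<in> D)" using ex1 neq by metis+
    ultimately have "({a, b} \<in> D) = (({a, c} \<in> D) = ({b, c} \<in> D))" using e(1) by blast
    then have "T \<notin> C"
      using hypercut_cocycle[OF C vV] D_link abc by simp
    moreover have "T \<in> triples n" "v \<notin> T" using T abc(1) by (auto simp: triples_def nsets_def V_def)
    ultimately show ?thesis by simp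
  qed
  have fin: "finite (triples n - C)" using finite_triples by simp
  have "O1 \<subseteq> triples n - C" using O1 by blast
  then have finO1: "finite O1" using fin by (rule finite_subset)
  have "card D + card O1 = card {T \<in> triples n - C. v \<in> T} + card O1"
    using card_complement_link[OF v, of C] by (simp add: D_def V_def)
  also have "\<dots> = card ({T \<in> triples n - C. v \<in> T} \<union> O1)"
    using O1 finite_triples finO1 by (intro card_Un_disjoint[symmetric]) auto
  also have "\<dots> \<le> card (triples n - C)" using O1 fin by (intro card_mono) auto
  finally have "card D + card O1 \<le> card (triples n - C)" .
  moreover have "n = Suc (card V)" using v by (simp add: V_def)
  ultimately show ?thesis using card_one_edge_triples by (simp add: O1_def mult.commute)
qed

lemma gallai_graph_complement_link:
  assumes C: "hypercut n C" and v: "v \<in> {1..n}"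
  defines "V \<equiv> {1..n} - {v}"
  defines "D \<equiv> complement_graph V (link n v C)"
  assumes sparse: "real (card D) + real (card V) ^ 2 / 4 < real (card V choose 2)"
  shows "gallai_graph V D"
proof -
  interpret fin_graph V D unfolding V_def D_def by (rule fin_graph_complement_link)
  have link: "nsets V 2 - D = link n v C" by (auto simp: D_def complement_graph_def link_def V_def)
  show ?thesis
  proof unfold_locales
    fix F assume F: "F \<subseteq> nsets V 2 - D" "F \<noteq> {}"
      and closed: "\<And>a b c. \<lbrakk>{a, b} \<in> F; {b, c} \<in> nsets V 2 - D; {a, c} \<in> D\<rbrakk> \<Longrightarrow> {b, c} \<in> F"
    show "F = nsets V 2 - D" unfolding link
    proof (rule link_single_class[OF C v])
      fix a b c assume abc: "{a, b} \<in> F" "{b, c} \<in> link n v C" "a \<noteq> c" "{a, c} \<notin> link n v C"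
      have "{a, b} \<in> nsets V 2" "{b, c} \<in> nsets V 2" using abc F(1) link by blast+
      then have "a \<in> V" "c \<in> V" by (simp_all add: nsets_def)
      then have "{a, c} \<in> nsets V 2" using abc(3) by (simp add: nsets_def card_insert_if)
      then have "{a, c} \<in> D" using abc(4) link by blast
      then show "{b, c} \<in> F" using closed abc(1,2) link by blast
    qed (use F link in auto)
  qed (rule sparse)
qed

text \<open>One \<open>\<rho>\<close> bounds all deviations, so the property is monotone in it and
  an error term can be chosen for each \<open>n\<close> as a least number.\<close>

definition extremal_link :: "nat \<Rightarrow> nat set set \<Rightarrow> real \<Rightarrow> bool" where
  "extremal_link n C \<rho> \<longleftrightarrow> (\<exists>v \<in> {1..n}.
     let V = {1..n} - {v};
         G = link n v C;
         G' = complement_graph V G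
     in
       (\<exists>u \<in> V.
          \<bar>real (degree G' u) - real n / 2\<bar> \<le> \<rho> \<and>
          (\<forall>w \<in> V - {u}. real (degree G' w) \<le> \<rho>) \<and>
          \<bar>real (card G') - (real n - 1)\<bar> \<le> \<rho>)
       \<or>
       (\<exists>x \<in> V. \<exists>y \<in> V. x \<noteq> y \<and>
          \<bar>real (degree G' x) - real n\<bar> \<le> \<rho> \<and>
          \<bar>real (degree G' y) - real n / 2\<bar> \<le> \<rho> \<and>
          (\<forall>w \<in> V - {x, y}. real (degree G' w) \<le> \<rho>) \<and>
          \<bar>real (card G') - 2 * real n\<bar> \<le> \<rho>))"

lemma extremal_link_mono:
  assumes "extremal_link n C \<rho>" "\<rho> \<le> \<rho>'"
  shows "extremal_link n C \<rho>'"
proof -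
  have le: "x \<le> \<rho>'" if "x \<le> \<rho>" for x using that assms(2) by (rule order_trans)
  show ?thesis
    using assms(1) unfolding extremal_link_def Let_def
  proof (elim bexE disjE conjE, goal_cases)
    case (1 v u)
    then show ?case by (intro bexI[of _ v] disjI1 bexI[of _ u] conjI ballI) (blast intro: le)+
  next
    case (2 v x y)
    then show ?case by (intro bexI[of _ v] disjI2 bexI[of _ x] bexI[of _ y] conjI ballI) (blast intro: le)+
  qed
qed

text \<open>This error is so crude that every link satisfies the first alternative; it supplies an
  admissible value for small \<open>n\<close>.\<close>

lemma extremal_link_trivial:
  assumes "2 \<le> n"
  shows "extremal_link n C (real (n\<^sup>2 + n))"
proof -
  let ?V = "{1..n} - {1 :: nat}"
  let ?D = "complement_graph ?V (link n 1 C)"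
  interpret fin_graph ?V ?D by (rule fin_graph_complement_link)
  have V: "card ?V \<le> n" "finite ?V" using card_Diff1_le[of "{1..n}" 1] by simp_all
  have d: "real (degree ?D u) \<le> real n" for u using degree_le[of u] V(1) by simp
  have "card ?D \<le> card (nsets ?V 2)"
    using D_subset finite_imp_finite_nsets[OF V(2)] by (rule card_mono[rotated])
  also have "\<dots> \<le> card ?V ^ 2" using binomial_fact_pow[of "card ?V" 2] by simp
  also have "\<dots> \<le> n\<^sup>2" using V(1) by (intro power_mono) auto
  finally have "real (card ?D) \<le> real (n\<^sup>2)" by (rule of_nat_mono)
  then have c: "\<bar>real (card ?D) - (real n - 1)\<bar> \<le> real (n\<^sup>2 + n)"
    using assms by (simp only: of_nat_add abs_le_iff) linarith
  have d1: "\<bar>real (degree ?D u) - real n / 2\<bar> \<le> real (n\<^sup>2 + n)" for u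
    using d[of u] by (simp only: of_nat_add abs_le_iff) linarith
  have d2: "real (degree ?D u) \<le> real (n\<^sup>2 + n)" for u
    using d[of u] unfolding of_nat_add by linarith
  have "1 \<in> {1..n}" "2 \<in> ?V" using assms by auto
  then show ?thesis
    unfolding extremal_link_def Let_def
    by (intro bexI[of _ 1] disjI1 bexI[of _ 2] conjI ballI c d1 d2)
qed

text \<open>\<open>K\<close> bounds the number of vertices of large degree, and
  \<open>n_large\<close> makes the terms depending only on that number at most
  \<open>\<epsilon> * n\<close>.\<close>

lemma hypercut_extremal_link:
  assumes \<epsilon>: "0 < \<epsilon>" "\<epsilon> \<le> 1 / 200" and n: "20 \<le> n"
    and K: "36 / \<epsilon> \<le> real K" and n_large: "real (1 + K + K\<^sup>2 + 2 ^ K) \<le> \<epsilon> * real n"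
    and C: "hypercut n C"
  defines "c \<equiv> real (card (triples n - C))"
  shows "(3 / 4 - 5 * \<epsilon>) * (real n)\<^sup>2 \<le> c"
    and "c \<le> (3 / 4 + \<epsilon>) * (real n)\<^sup>2 \<Longrightarrow> extremal_link n C (200 * \<epsilon> * real n + 1)"
proof -
  have n0: "real n > 0" using n by simp
  \<comment> \<open>For larger \<open>c\<close> the lower bound is immediate, so both claims may
    assume this upper bound, which makes \<open>m\<close> linear in \<open>n\<close>.\<close>
  have main: "(3 / 4 - 5 * \<epsilon>) * (real n)\<^sup>2 \<le> c \<and> extremal_link n C (200 * \<epsilon> * real n + 1)"
    if c_le: "c \<le> (3 / 4 + \<epsilon>) * (real n)\<^sup>2"
  proof -
    obtain v where v: "v \<in> {1..n}"
      and v_min: "n * card (complement_graph ({1..n} - {v}) (link n v C)) \<le> 3 * card (triples n - C)"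
      using exists_sparse_complement_link[of n C] n by auto
    define V where "V = {1..n} - {v}"
    define D where "D = complement_graph V (link n v C)"
    define d where "d u = real (degree D u)" for u
    define m where "m = real (card D)"
    have cV: "card V = n - 1" using v by (simp add: V_def)
    have "real (n * card D) \<le> real (3 * card (triples n - C))"
      using v_min unfolding D_def V_def by (rule of_nat_mono)
    then have mc: "real n * m \<le> 3 * c" by (simp add: m_def c_def)
    have "(3 / 4 + \<epsilon>) * (real n)\<^sup>2 \<le> 1 * (real n)\<^sup>2" using \<epsilon> by (intro mult_right_mono) auto
    with c_le have "3 * c \<le> real n * (3 * real n)" by (simp add: power2_eq_square)
    with mc have "real n * m \<le> real n * (3 * real n)" by (rule order_trans)
    then have m_le: "m \<le> 3 * real n" using n0 by (simp add: mult_le_cancel_left_pos)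
    have sparse: "real (card D) + real (card V) ^ 2 / 4 < real (card V choose 2)"
    proof -
      have "real (card V choose 2) = real (card V) * (real (card V) - 1) / 2"
        using n by (simp add: choose_two real_of_nat_div cV)
      moreover have "real (card V) = real n - 1" using cV n by simp
      moreover have "3 * real n + (real n - 1)\<^sup>2 / 4 < (real n - 1) * (real n - 1 - 1) / 2"
      proof -
        have "0 \<le> (real n - 20) * (real n + 4)" using n by simp
        then show ?thesis using n by (simp add: power2_eq_square field_simps)
      qed
      ultimately show ?thesis using m_le unfolding m_def by simp
    qed
    interpret gallai_graph V D
      unfolding V_def D_def
      by (rule gallai_graph_complement_link[OF C v]) (use sparse in \<open>simp add: V_def D_def\<close>)
    have sum_d: "(\<Sum>u\<in>V. d u) = 2 * m"
      using sum_degree unfolding d_def m_def by (metis of_nat_sum of_nat_mult of_nat_numeral)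
    \<comment> \<open>With \<open>2 * m \<le> 6 * n\<close>, the threshold leaves at most
      \<open>36 / \<epsilon>\<close> vertices in \<open>S\<close> and bounds the squared degrees
      outside \<open>S\<close> by \<open>\<epsilon> * n ^ 2\<close> in total.\<close>
    define S where "S = {u \<in> V. \<epsilon> / 6 * real n < d u}"
    have S: "S \<subseteq> V" "finite S" using finite_V by (auto simp: S_def)
    have "real (card S) * (\<epsilon> / 6 * real n) = (\<Sum>u\<in>S. \<epsilon> / 6 * real n)" by simp
    also have "\<dots> \<le> (\<Sum>u\<in>S. d u)" by (intro sum_mono) (simp add: S_def)
    also have "\<dots> \<le> (\<Sum>u\<in>V. d u)" using S finite_V by (intro sum_mono2) (auto simp: d_def)
    finally have "real (card S) * (\<epsilon> / 6 * real n) \<le> 6 * real n" using sum_d m_le by linarith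
    then have "real (card S) \<le> 36 / \<epsilon>" using n0 \<epsilon> by (simp add: field_simps)
    then have "real (card S) \<le> real K" using K by linarith
    then have kK: "card S \<le> K" by simp
    have "1 + card S + (card S)\<^sup>2 + 2 ^ card S \<le> 1 + K + K\<^sup>2 + 2 ^ K"
      using kK by (intro add_mono power_mono power_increasing) auto
    then have "real (1 + card S + (card S)\<^sup>2 + 2 ^ card S) \<le> real (1 + K + K\<^sup>2 + 2 ^ K)"
      by (rule of_nat_mono)
    then have k_small: "1 + real (card S) + (real (card S))\<^sup>2 + 2 ^ card S \<le> \<epsilon> * real n"
      using n_large by simp
    have k_nonneg: "0 \<le> (real (card S))\<^sup>2" "(0::real) \<le> 2 ^ card S" by simp_all
    obtain q b where q1: "card V + (\<Sum>i\<in>S. degree D i) \<le> card D + q + card S + card S ^ 2"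
      and q2: "2 * q \<le> card V + 2 ^ card S"
      and q3: "q \<le> (\<Sum>i\<in>S. b i) + 2 ^ card S"
      and b: "\<And>i. b i \<le> q" "\<And>i. b i \<le> degree D i" "\<And>i. b i + degree D i \<le> card V"
      using structure_at_subset[OF S(1)] by blast
    have edge_count: "real n * m \<le> c + (\<Sum>u\<in>V. (d u)\<^sup>2)"
    proof -
      have "real (n * card D) \<le> real (card (triples n - C) + (\<Sum>u\<in>V. degree D u ^ 2))"
        using card_complement_hypercut_ge[OF C v] unfolding V_def D_def by (rule of_nat_mono)
      then show ?thesis by (simp add: m_def c_def d_def)
    qed
    have "(\<Sum>u\<in>V. (d u)\<^sup>2) = (\<Sum>u\<in>S. (d u)\<^sup>2) + (\<Sum>u\<in>V - S. (d u)\<^sup>2)"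
      using sum.subset_diff[OF S(1) finite_V, of "\<lambda>u. (d u)\<^sup>2"] by (simp add: add.commute)
    also have "(\<Sum>u\<in>V - S. (d u)\<^sup>2) \<le> (\<Sum>u\<in>V - S. \<epsilon> / 6 * real n * d u)"
      unfolding power2_eq_square by (intro sum_mono mult_right_mono) (auto simp: S_def d_def)
    also have "\<dots> \<le> (\<Sum>u\<in>V. \<epsilon> / 6 * real n * d u)"
      using finite_V \<epsilon> by (intro sum_mono2) (auto simp: d_def)
    also have "\<dots> = \<epsilon> / 3 * real n * m" unfolding sum_distrib_left[symmetric] sum_d by simp
    also have "\<dots> \<le> \<epsilon> / 3 * real n * (3 * real n)" using m_le \<epsilon> by (intro mult_left_mono) auto
    finally have sum_sq: "(\<Sum>u\<in>V. (d u)\<^sup>2) \<le> (\<Sum>u\<in>S. (d u)\<^sup>2) + \<epsilon> * (real n)\<^sup>2"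
      by (simp add: power2_eq_square)
    interpret W: degree_weights S "\<lambda>i. d i / real n" "\<lambda>i. real (b i) / real n" "c / (real n)\<^sup>2"
      "m / real n" "real q / real n" \<epsilon>
    proof
      have "real n * m - (\<Sum>u\<in>S. (d u)\<^sup>2) - \<epsilon> * (real n)\<^sup>2 \<le> c" using edge_count sum_sq by linarith
      then have "(real n * m - (\<Sum>u\<in>S. (d u)\<^sup>2) - \<epsilon> * (real n)\<^sup>2) / (real n)\<^sup>2 \<le> c / (real n)\<^sup>2"
        by (rule divide_right_mono) simp
      moreover have "(real n * m - (\<Sum>u\<in>S. (d u)\<^sup>2) - \<epsilon> * (real n)\<^sup>2) / (real n)\<^sup>2
          = m / real n - (\<Sum>i\<in>S. (d i / real n)\<^sup>2) - \<epsilon>"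
        using n0 by (simp add: diff_divide_distrib power_divide sum_divide_distrib power2_eq_square)
      ultimately show "m / real n - (\<Sum>i\<in>S. (d i / real n)\<^sup>2) - \<epsilon> \<le> c / (real n)\<^sup>2" by simp
      have "real (card V + (\<Sum>i\<in>S. degree D i)) \<le> real (card D + q + card S + card S ^ 2)"
        using q1 by (rule of_nat_mono)
      then have "real n - 1 + (\<Sum>i\<in>S. d i) \<le> m + real q + real (card S) + (real (card S))\<^sup>2"
        using n by (simp add: cV d_def m_def)
      then have "real n - real q + (\<Sum>i\<in>S. d i) - \<epsilon> * real n \<le> m"
        using k_small k_nonneg by linarith
      then have "(real n - real q + (\<Sum>i\<in>S. d i) - \<epsilon> * real n) / real n \<le> m / real n"
        by (rule divide_right_mono) simp
      then show "1 - real q / real n + (\<Sum>i\<in>S. d i / real n) - \<epsilon> \<le> m / real n"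
        using n0 by (simp add: diff_divide_distrib add_divide_distrib sum_divide_distrib)
      have "real q \<le> real ((\<Sum>i\<in>S. b i) + 2 ^ card S)" using q3 by (rule of_nat_mono)
      then have "real q \<le> (\<Sum>i\<in>S. real (b i)) + 2 ^ card S" by simp
      then have "real q - \<epsilon> * real n \<le> (\<Sum>i\<in>S. real (b i))" using k_small k_nonneg by linarith
      then have "(real q - \<epsilon> * real n) / real n \<le> (\<Sum>i\<in>S. real (b i)) / real n"
        by (rule divide_right_mono) simp
      then show "real q / real n - \<epsilon> \<le> (\<Sum>i\<in>S. real (b i) / real n)"
        using n0 by (simp add: diff_divide_distrib sum_divide_distrib)
      have "real (2 * q) \<le> real (card V + 2 ^ card S)" using q2 by (rule of_nat_mono)
      then have "2 * real q \<le> real n - 1 + 2 ^ card S" using n by (simp add: cV)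
      moreover have "0 \<le> \<epsilon> * real n" using \<epsilon> by simp
      ultimately have "real q \<le> real n / 2 + \<epsilon> * real n" using k_small k_nonneg by linarith
      then show "real q / real n \<le> 1 / 2 + \<epsilon>" using n0 by (simp add: field_simps)
    next
      fix i
      show "real (b i) / real n \<le> real q / real n" using b(1) by (simp add: divide_right_mono)
      show "real (b i) / real n \<le> d i / real n" using b(2) by (simp add: d_def divide_right_mono)
      have "b i + degree D i \<le> n" using b(3)[of i] cV by simp
      then have "real (b i) + d i \<le> real n" unfolding d_def by (metis of_nat_add of_nat_mono)
      then show "real (b i) / real n + d i / real n \<le> 1" using n0 by (simp add: field_simps)
    qed (use S \<epsilon> in auto)
    have lower: "(3 / 4 - 5 * \<epsilon>) * (real n)\<^sup>2 \<le> c"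
      using W.lower_bound n0 by (simp add: pos_le_divide_eq)
    have "c / (real n)\<^sup>2 \<le> 3 / 4 + \<epsilon>" using c_le n0 by (simp add: pos_divide_le_eq)
    moreover have "m / real n \<le> 3 * (c / (real n)\<^sup>2)"
      using mc n0 by (simp add: power2_eq_square field_simps)
    ultimately obtain y where y: "y \<in> S" "\<bar>d y / real n - 1 / 2\<bar> \<le> 200 * \<epsilon>" and alt:
      "(\<forall>i\<in>S - {y}. d i / real n \<le> 200 * \<epsilon>) \<and> \<bar>m / real n - 1\<bar> \<le> 200 * \<epsilon> \<or>
       (\<exists>x\<in>S - {y}. \<bar>d x / real n - 1\<bar> \<le> 200 * \<epsilon> \<and> (\<forall>i\<in>S - {x, y}. d i / real n \<le> 200 * \<epsilon>)
         \<and> \<bar>m / real n - 2\<bar> \<le> 200 * \<epsilon>)"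
      using W.near_extremal by blast
    \<comment> \<open>The additional 1 covers the difference between \<open>n\<close> and
      \<open>n - 1\<close> in the edge count.\<close>
    define \<rho> where "\<rho> = 200 * \<epsilon> * real n + 1"
    have scale: "\<bar>z - a * real n\<bar> \<le> 200 * \<epsilon> * real n" if "\<bar>z / real n - a\<bar> \<le> 200 * \<epsilon>" for z a
    proof -
      have "z - a * real n = (z / real n - a) * real n" using n0 by (simp add: field_simps)
      then have "\<bar>z - a * real n\<bar> = \<bar>z / real n - a\<bar> * real n" by (simp add: abs_mult)
      then show ?thesis using that by (simp add: mult_right_mono)
    qed
    have small: "d i \<le> \<rho>" if "i \<in> S \<Longrightarrow> d i / real n \<le> 200 * \<epsilon>" "i \<in> V" for i
    proof (cases "i \<in> S")
      case True
      then show ?thesis using that(1) n0 by (simp add: \<rho>_def pos_divide_le_eq)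
    next
      case False
      then have "d i \<le> \<epsilon> / 6 * real n" using that(2) by (simp add: S_def)
      moreover have "0 \<le> \<epsilon> * real n" using \<epsilon> by simp
      ultimately show ?thesis by (simp add: \<rho>_def)
    qed
    have dy: "\<bar>d y - real n / 2\<bar> \<le> \<rho>" using scale[OF y(2)] by (simp add: \<rho>_def)
    have "extremal_link n C \<rho>"
      using alt
    proof
      assume one: "(\<forall>i\<in>S - {y}. d i / real n \<le> 200 * \<epsilon>) \<and> \<bar>m / real n - 1\<bar> \<le> 200 * \<epsilon>"
      have "\<bar>m - (real n - 1)\<bar> \<le> \<rho>" using scale[of m 1] one by (simp add: \<rho>_def)
      moreover have "\<forall>w\<in>V - {y}. d w \<le> \<rho>" using one small by auto
      moreover have "y \<in> V" using y(1) S(1) by blast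
      ultimately show ?thesis
        using dy unfolding extremal_link_def Let_def
        by (intro bexI[OF _ v], fold V_def, fold D_def, fold d_def m_def)
          (intro disjI1 bexI[of _ y] conjI)
    next
      assume "\<exists>x\<in>S - {y}. \<bar>d x / real n - 1\<bar> \<le> 200 * \<epsilon> \<and> (\<forall>i\<in>S - {x, y}. d i / real n \<le> 200 * \<epsilon>)
         \<and> \<bar>m / real n - 2\<bar> \<le> 200 * \<epsilon>"
      then obtain x where x: "x \<in> S - {y}" "\<bar>d x / real n - 1\<bar> \<le> 200 * \<epsilon>"
        "\<forall>i\<in>S - {x, y}. d i / real n \<le> 200 * \<epsilon>" "\<bar>m / real n - 2\<bar> \<le> 200 * \<epsilon>" by blast
      have "\<bar>m - 2 * real n\<bar> \<le> \<rho>" "\<bar>d x - real n\<bar> \<le> \<rho>"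
        using scale[OF x(4)] scale[OF x(2)] by (simp_all add: \<rho>_def)
      moreover have "\<forall>w\<in>V - {x, y}. d w \<le> \<rho>" using x(3) small by auto
      moreover have "x \<in> V" "y \<in> V" "x \<noteq> y" using x(1) y(1) S(1) by blast+
      ultimately show ?thesis
        using dy unfolding extremal_link_def Let_def
        by (intro bexI[OF _ v], fold V_def, fold D_def, fold d_def m_def)
          (intro disjI2 bexI[of _ x] bexI[of _ y] conjI)
    qed
    with lower show ?thesis by (simp add: \<rho>_def)
  qed
  then show "c \<le> (3 / 4 + \<epsilon>) * (real n)\<^sup>2 \<Longrightarrow> extremal_link n C (200 * \<epsilon> * real n + 1)" by blast
  show "(3 / 4 - 5 * \<epsilon>) * (real n)\<^sup>2 \<le> c"
  proof (cases "c \<le> (3 / 4 + \<epsilon>) * (real n)\<^sup>2")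
    case True
    then show ?thesis using main by blast
  next
    case False
    moreover have "(3 / 4 - 5 * \<epsilon>) * (real n)\<^sup>2 \<le> (3 / 4 + \<epsilon>) * (real n)\<^sup>2"
      using \<epsilon> by (intro mult_right_mono) auto
    ultimately show ?thesis by linarith
  qed
qed

text \<open>\<open>K\<close> and \<open>N\<close> depend on \<open>\<epsilon>\<close> alone, so one
  threshold for \<open>n\<close> serves all hypercuts.\<close>

lemma eventually_hypercut_extremal_link:
  assumes \<epsilon>: "0 < \<epsilon>" "\<epsilon> \<le> 1 / 200"
  shows "\<forall>\<^sub>F n in sequentially. \<forall>C. hypercut n C \<longrightarrow>
    (3 / 4 - 5 * \<epsilon>) * (real n)\<^sup>2 \<le> real (card (triples n - C)) \<and>
    (real (card (triples n - C)) \<le> (3 / 4 + \<epsilon>) * (real n)\<^sup>2 \<longrightarrow>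
      extremal_link n C (200 * \<epsilon> * real n + 1))"
proof -
  obtain K :: nat where K: "36 / \<epsilon> \<le> real K" using real_arch_simple by blast
  obtain N :: nat where N: "real (1 + K + K\<^sup>2 + 2 ^ K) / \<epsilon> \<le> real N" using real_arch_simple by blast
  show ?thesis
    using eventually_ge_at_top[of "max 20 N"]
  proof eventually_elim
    case (elim n)
    have "real (1 + K + K\<^sup>2 + 2 ^ K) / \<epsilon> \<le> real n" using N elim by simp
    then have "real (1 + K + K\<^sup>2 + 2 ^ K) \<le> \<epsilon> * real n"
      using \<epsilon> by (simp only: pos_divide_le_eq mult.commute)
    then show ?case using hypercut_extremal_link[OF \<epsilon> _ K] elim by simp
  qed
qed

text \<open>The least admissible \<open>k\<close> for each \<open>n\<close> lies below every bound
  that eventually holds, so a single function works for all \<open>\<epsilon>\<close>.\<close>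

lemma exists_smallo_witness:
  fixes g :: "nat \<Rightarrow> real"
  assumes ex: "\<And>n. \<exists>k :: nat. P n k"
    and small: "\<And>\<epsilon>. 0 < \<epsilon> \<Longrightarrow> \<forall>\<^sub>F n in sequentially. \<exists>k. P n k \<and> real k \<le> \<epsilon> * g n"
  shows "\<exists>h \<in> o(g). \<forall>n. \<exists>k. h n = real k \<and> P n k"
proof
  let ?h = "\<lambda>n. real (LEAST k. P n k)"
  show "?h \<in> o(g)"
  proof (rule landau_o.smallI)
    fix \<epsilon> :: real assume \<epsilon>: "0 < \<epsilon>"
    show "\<forall>\<^sub>F n in sequentially. norm (?h n) \<le> \<epsilon> * norm (g n)"
      using small[OF \<epsilon>]
    proof eventually_elim
      case (elim n)
      then obtain k where k: "P n k" "real k \<le> \<epsilon> * g n" by blast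
      have "?h n \<le> real k" using Least_le[of "P n", OF k(1)] by simp
      also note k(2)
      also have "\<epsilon> * g n \<le> \<epsilon> * norm (g n)" using \<epsilon> by (intro mult_left_mono) auto
      finally show ?case by simp
    qed
  qed
  show "\<forall>n. \<exists>k. ?h n = real k \<and> P n k" using LeastI_ex[OF ex] by blast
qed

lemma card_hypercut:
  assumes "hypercut n C"
  shows "real (card C) = real (n choose 3) - real (card (triples n - C))"
proof -
  have "C \<subseteq> triples n" using assms by (simp add: hypercut_def)
  then have "card (triples n - C) + card C = card (triples n)"
    using finite_triples by (metis card_Diff_subset card_mono finite_subset le_add_diff_inverse2)
  moreover have "card (triples n) = n choose 3" by (simp add: triples_def)
  ultimately show ?thesis by linarith
qed

theorem theorem4:
  shows
    "(\<exists>h \<in> o(\<lambda>n. real n ^ 2). \<forall>n C. hypercut n C \<longrightarrow>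
        real (card C) \<le> real (n choose 3) - 3 / 4 * real n ^ 2 + h n)
     \<and>
     (\<forall>h \<in> o(\<lambda>n. real n ^ 2). \<exists>r \<in> o(\<lambda>n. real n). \<forall>n C.
        hypercut n C \<and>
        \<bar>real (card C) - (real (n choose 3) - 3 / 4 * real n ^ 2)\<bar> \<le> h n \<longrightarrow>
        (\<exists>v \<in> {1..n}.
           let V = {1..n} - {v};
               G = link n v C;
               G' = complement_graph V G
           in
             (\<exists>u \<in> V.
                \<bar>real (degree G' u) - real n / 2\<bar> \<le> r n \<and>
                (\<forall>w \<in> V - {u}. real (degree G' w) \<le> r n) \<and>
                \<bar>real (card G') - (real n - 1)\<bar> \<le> r n)
             \<or>
             (\<exists>x \<in> V. \<exists>y \<in> V. x \<noteq> y \<and>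
                \<bar>real (degree G' x) - real n\<bar> \<le> r n \<and>
                \<bar>real (degree G' y) - real n / 2\<bar> \<le> r n \<and>
                (\<forall>w \<in> V - {x, y}. real (degree G' w) \<le> r n) \<and>
                \<bar>real (card G') - 2 * real n\<bar> \<le> r n)))"
proof (intro conjI ballI)
  have "\<exists>h \<in> o(\<lambda>n. real n ^ 2). \<forall>n. \<exists>k. h n = real k \<and> (\<forall>C. hypercut n C \<longrightarrow>
      real (card C) \<le> real (n choose 3) - 3 / 4 * real n ^ 2 + real k)"
  proof (rule exists_smallo_witness)
    fix n
    show "\<exists>k. \<forall>C. hypercut n C \<longrightarrow> real (card C) \<le> real (n choose 3) - 3 / 4 * real n ^ 2 + real k"
      by (intro exI[of _ "n\<^sup>2"]) (auto simp: card_hypercut intro: order_trans[of _ "0 :: real"])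
  next
    fix \<epsilon> :: real assume \<epsilon>: "0 < \<epsilon>"
    \<comment> \<open>The loss \<open>5 * \<epsilon>'\<close> is at most
      \<open>\<epsilon> / 4\<close>; the rest absorbs rounding up, since \<open>N\<close> ensures
      \<open>2 \<le> \<epsilon> * n ^ 2\<close>.\<close>
    define \<epsilon>' where "\<epsilon>' = min (\<epsilon> / 20) (1 / 200)"
    have \<epsilon>': "0 < \<epsilon>'" "\<epsilon>' \<le> 1 / 200" "\<epsilon>' \<le> \<epsilon> / 20" using \<epsilon> by (auto simp: \<epsilon>'_def)
    obtain N :: nat where N: "2 / \<epsilon> \<le> real N" using real_arch_simple by blast
    show "\<forall>\<^sub>F n in sequentially. \<exists>k. (\<forall>C. hypercut n C \<longrightarrow>
        real (card C) \<le> real (n choose 3) - 3 / 4 * real n ^ 2 + real k) \<and> real k \<le> \<epsilon> * real n ^ 2"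
      using eventually_hypercut_extremal_link[OF \<epsilon>'(1,2)] eventually_ge_at_top[of "max 1 N"]
    proof eventually_elim
      case (elim n)
      have "2 / \<epsilon> \<le> real n" using N elim(2) by simp
      also have "real n \<le> real n ^ 2" using elim(2) by (simp add: self_le_power)
      finally have "2 \<le> \<epsilon> * real n ^ 2" using \<epsilon> by (simp add: pos_divide_le_eq mult.commute)
      moreover have "5 * \<epsilon>' * real n ^ 2 \<le> \<epsilon> / 4 * real n ^ 2" using \<epsilon>' by (intro mult_right_mono) auto
      ultimately have "5 * \<epsilon>' * real n ^ 2 + 1 \<le> \<epsilon> * real n ^ 2" by linarith
      moreover have "0 \<le> 5 * \<epsilon>' * real n ^ 2" using \<epsilon>' by simp
      ultimately have k: "real (nat \<lceil>5 * \<epsilon>' * real n ^ 2\<rceil>) \<le> \<epsilon> * real n ^ 2" by linarith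
      have "real (card C) \<le> real (n choose 3) - 3 / 4 * real n ^ 2 + real (nat \<lceil>5 * \<epsilon>' * real n ^ 2\<rceil>)"
        if C: "hypercut n C" for C
      proof -
        have "3 / 4 * real n ^ 2 - 5 * \<epsilon>' * real n ^ 2 \<le> real (card (triples n - C))"
          using elim(1) C by (simp add: left_diff_distrib)
        then show ?thesis unfolding card_hypercut[OF C] by linarith
      qed
      then show ?case using k by blast
    qed
  qed
  then show "\<exists>h \<in> o(\<lambda>n. real n ^ 2). \<forall>n C. hypercut n C \<longrightarrow>
        real (card C) \<le> real (n choose 3) - 3 / 4 * real n ^ 2 + h n" by metis
next
  fix h :: "nat \<Rightarrow> real" assume h: "h \<in> o(\<lambda>n. real n ^ 2)"
  let ?near = "\<lambda>n C. \<bar>real (card C) - (real (n choose 3) - 3 / 4 * real n ^ 2)\<bar> \<le> h n"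
  have "\<exists>r \<in> o(\<lambda>n. real n). \<forall>n. \<exists>k. r n = real k \<and>
      (\<forall>C. hypercut n C \<and> ?near n C \<longrightarrow> extremal_link n C (real k))"
  proof (rule exists_smallo_witness)
    fix n
    have "extremal_link n C (real (n\<^sup>2 + n))" if "hypercut n C" for C
      using hypercut_imp_ge_3[OF that] by (intro extremal_link_trivial) simp
    then show "\<exists>k. \<forall>C. hypercut n C \<and> ?near n C \<longrightarrow> extremal_link n C (real k)" by blast
  next
    fix \<epsilon> :: real assume \<epsilon>: "0 < \<epsilon>"
    \<comment> \<open>Now \<open>200 * \<epsilon>'\<close> is at most \<open>\<epsilon> / 4\<close>;
      the rest absorbs the constant 1 and rounding up, since \<open>N\<close> ensures
      \<open>4 \<le> \<epsilon> * n\<close>.\<close>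
    define \<epsilon>' where "\<epsilon>' = min (\<epsilon> / 800) (1 / 200)"
    have \<epsilon>': "0 < \<epsilon>'" "\<epsilon>' \<le> 1 / 200" "\<epsilon>' \<le> \<epsilon> / 800" using \<epsilon> by (auto simp: \<epsilon>'_def)
    obtain N :: nat where N: "4 / \<epsilon> \<le> real N" using real_arch_simple by blast
    show "\<forall>\<^sub>F n in sequentially. \<exists>k. (\<forall>C. hypercut n C \<and> ?near n C \<longrightarrow> extremal_link n C (real k))
        \<and> real k \<le> \<epsilon> * real n"
      using eventually_hypercut_extremal_link[OF \<epsilon>'(1,2)] landau_o.smallD[OF h \<epsilon>'(1)]
        eventually_ge_at_top[of N]
    proof eventually_elim
      case (elim n)
      have "4 / \<epsilon> \<le> real n" using N elim(3) by simp
      then have "4 \<le> \<epsilon> * real n" using \<epsilon> by (simp add: pos_divide_le_eq mult.commute)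
      moreover have "200 * \<epsilon>' * real n \<le> \<epsilon> / 4 * real n" using \<epsilon>' by (intro mult_right_mono) auto
      ultimately have "200 * \<epsilon>' * real n + 2 \<le> \<epsilon> * real n" by linarith
      moreover have "0 \<le> 200 * \<epsilon>' * real n" using \<epsilon>' by simp
      ultimately have k: "real (nat \<lceil>200 * \<epsilon>' * real n + 1\<rceil>) \<le> \<epsilon> * real n" by linarith
      have "extremal_link n C (real (nat \<lceil>200 * \<epsilon>' * real n + 1\<rceil>))"
        if C: "hypercut n C" and near: "?near n C" for C
      proof -
        have "real (card (triples n - C)) \<le> 3 / 4 * real n ^ 2 + h n"
          using near unfolding card_hypercut[OF C] by linarith
        \<comment> \<open>Using \<open>\<epsilon>'\<close> also as the constant for \<open>h\<close>
          brings \<open>C\<close> into the range of the structural estimate.\<close>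
        moreover have "h n \<le> \<epsilon>' * real n ^ 2" using elim(2) by simp
        ultimately have "real (card (triples n - C)) \<le> (3 / 4 + \<epsilon>') * real n ^ 2"
          by (simp add: distrib_right)
        then have "extremal_link n C (200 * \<epsilon>' * real n + 1)" using elim(1) C by blast
        then show ?thesis by (rule extremal_link_mono) linarith
      qed
      then show ?case using k by blast
    qed
  qed
  then obtain r where "r \<in> o(\<lambda>n. real n)"
    and "\<And>n C. hypercut n C \<and> ?near n C \<Longrightarrow> extremal_link n C (r n)" by metis
  then show "\<exists>r \<in> o(\<lambda>n. real n). \<forall>n C. hypercut n C \<and> ?near n C \<longrightarrow>
        (\<exists>v \<in> {1..n}.
           let V = {1..n} - {v};
               G = link n v C;
               G' = complement_graph V G
           in
             (\<exists>u \<in> V.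
                \<bar>real (degree G' u) - real n / 2\<bar> \<le> r n \<and>
                (\<forall>w \<in> V - {u}. real (degree G' w) \<le> r n) \<and>
                \<bar>real (card G') - (real n - 1)\<bar> \<le> r n)
             \<or>
             (\<exists>x \<in> V. \<exists>y \<in> V. x \<noteq> y \<and>
                \<bar>real (degree G' x) - real n\<bar> \<le> r n \<and>
                \<bar>real (degree G' y) - real n / 2\<bar> \<le> r n \<and>
                (\<forall>w \<in> V - {x, y}. real (degree G' w) \<le> r n) \<and>
                \<bar>real (card G') - 2 * real n\<bar> \<le> r n))"
    unfolding extremal_link_def by blast
qed

end
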